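(* Let $m$ be a positive even integer and define, for $z\in\mathbb{C}$ and $\tau\in\mathbb{H}$, $$\varphi(z;\tau):=\left(\frac{\vartheta\left(z+\frac12;\tau\right)}{\vartheta(z;\tau)}\right)^m,$$ with Fourier expansion $\varphi(z;\tau)=\sum_{r\in\mathbb{Z}}\chi_r(\tau)\zeta^r$ ($\zeta=e^{2\pi i z}$) valid for $0<\operatorname{Im}(z)<\operatorname{Im}(\tau)$. Let $D_0,D_2,\dots,D_m$ be the functions defined by the Laurent expansion at $z=0$ $$\varphi(z;\tau)=\sum_{j=0}^{m/2}\frac{D_{2j}(\tau)}{(2\pi i z)^{2j}}+O\left(z^2\right).$$ Then for $r\in\mathbb{Z}$, $$\chi_r(\tau)=\frac{1}{1-q^r}\sum_{j=1}^{m/2}\frac{r^{2j-1}}{(2j-1)!}D_{2j}(\tau)\quad (r\neq 0),\qquad \chi_0(\tau)=D_0(\tau)+\sum_{j=1}^{m/2}\frac{B_{2j}}{(2j)!}D_{2j}(\tau)E_{2j}(\tau),$$ and for each $0\le j\le m/2$ the function $D_{2j}(\tau)$ is a modular form of weight $-2j$ on $\Gamma_0(2)$ with Nebentypus character $\psi$, i.e. $D_{2j}(\gamma\tau)=\psi(\gamma)(c\tau+d)^{-2j}D_{2j}(\tau)$ for all $\gamma=\begin{pmatrix}a&b\\c&d\end{pmatrix}\in\Gamma_0(2)$.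
   Context: $q:=e^{2\pi i\tau}$. Jacobi's theta function is $\vartheta(z;\tau):=\sum_{\nu\in\frac12+\mathbb{Z}}e^{\pi i\nu^2\tau+2\pi i\nu\left(z+\frac12\right)}$. The Bernoulli numbers $B_r$ are defined by $\frac{t}{e^t-1}=\sum_{r\ge0}B_r\frac{t^r}{r!}$. For integers $j\ge1$, $E_{2j}(\tau):=1-\frac{4j}{B_{2j}}\sum_{\ell\ge1}\sigma_{2j-1}(\ell)q^\ell$ with $\sigma_s(\ell)=\sum_{d\mid\ell}d^s$. For $\gamma=\begin{pmatrix}a&b\\c&d\end{pmatrix}\in\Gamma_0(2)$ the character is $\psi(\gamma)=\psi_m(\gamma):=(-1)^{\frac{mc}{4}}$. *)

theory Defs
  imports "HOL-Complex_Analysis.Complex_Analysis"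
begin

abbreviation upper_half_plane :: "complex set" where
  "upper_half_plane \<equiv> {\<tau>. 0 < Im \<tau>}"

definition nome :: "complex \<Rightarrow> complex" where
  "nome \<tau> = exp (2 * of_real pi * \<i> * \<tau>)"

text \<open>The summation variable \<open>\<nu> \<in> 1/2 + \<int>\<close> is written as \<open>\<nu> = n + 1/2\<close>.\<close>

definition jacobi_theta :: "complex \<Rightarrow> complex \<Rightarrow> complex" where
  "jacobi_theta z \<tau> =
     (\<Sum>\<^sub>\<infinity>n\<in>(UNIV :: int set). let \<nu> = of_int n + 1/2 in
        exp (of_real pi * \<i> * \<nu>\<^sup>2 * \<tau> + 2 * of_real pi * \<i> * \<nu> * (z + 1/2)))"

definition phi :: "nat \<Rightarrow> complex \<Rightarrow> complex \<Rightarrow> complex" where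
  "phi m z \<tau> = (jacobi_theta (z + 1/2) \<tau> / jacobi_theta z \<tau>) ^ m"

definition has_fourier_expansion :: "nat \<Rightarrow> complex \<Rightarrow> (int \<Rightarrow> complex) \<Rightarrow> bool" where
  "has_fourier_expansion m \<tau> c \<longleftrightarrow>
     (\<forall>z. 0 < Im z \<and> Im z < Im \<tau> \<longrightarrow>
        ((\<lambda>r. c r * exp (2 * of_real pi * \<i> * z) powi r) has_sum phi m z \<tau>) UNIV)"

text \<open>That such an expansion exists, so that the definite description denotes it, is not
  presupposed here; it is part of what has to be proved.\<close>

definition chi :: "nat \<Rightarrow> int \<Rightarrow> complex \<Rightarrow> complex" where
  "chi m r \<tau> = (THE c. has_fourier_expansion m \<tau> c) r"

text \<open>\<open>D m k\<close> is the coefficient of \<open>1 / (2 \<pi> \<i> z)\<^sup>k\<close> (not of \<open>1 / z\<^sup>k\<close>) in the Laurent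
  expansion of \<open>phi m\<close> at \<open>z = 0\<close>.\<close>

definition D :: "nat \<Rightarrow> nat \<Rightarrow> complex \<Rightarrow> complex" where
  "D m k \<tau> = (2 * of_real pi * \<i>) ^ k *
     fls_nth (laurent_expansion (\<lambda>z. phi m z \<tau>) 0) (- int k)"

definition bernoulli_number :: "nat \<Rightarrow> real" where
  "bernoulli_number r = fact r * fps_nth (fps_X / (fps_exp 1 - 1)) r"

definition divisor_power_sum :: "nat \<Rightarrow> nat \<Rightarrow> nat" where
  "divisor_power_sum s l = (\<Sum>d | d dvd l. d ^ s)"

text \<open>\<open>eisenstein_E k\<close> is the normalised Eisenstein series of weight \<open>k\<close>; for \<open>k = 2 * j\<close> the
  factor \<open>2 * k / B\<^sub>k\<close> is \<open>4 * j / B\<^bsub>2 * j\<^esub>\<close>.\<close>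

definition eisenstein_E :: "nat \<Rightarrow> complex \<Rightarrow> complex" where
  "eisenstein_E k \<tau> = 1 - of_nat (2 * k) / of_real (bernoulli_number k) *
     (\<Sum>\<^sub>\<infinity>l\<in>{1..}. of_nat (divisor_power_sum (k - 1) l) * nome \<tau> ^ l)"

definition Gamma0 :: "int \<Rightarrow> (int ^ 2 ^ 2) set" where
  "Gamma0 N = {A. det A = 1 \<and> N dvd A $ 2 $ 1}"

definition mat_act :: "int ^ 2 ^ 2 \<Rightarrow> complex \<Rightarrow> complex" where
  "mat_act A = moebius (of_int (A $ 1 $ 1)) (of_int (A $ 1 $ 2))
                       (of_int (A $ 2 $ 1)) (of_int (A $ 2 $ 2))"

definition automorphy_factor :: "int ^ 2 ^ 2 \<Rightarrow> complex \<Rightarrow> complex" where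
  "automorphy_factor A \<tau> = of_int (A $ 2 $ 1) * \<tau> + of_int (A $ 2 $ 2)"

text \<open>The division by 4 is exact in the only case of interest, \<open>m\<close> even and \<open>A \<in> Gamma0 2\<close>.\<close>

definition psi :: "nat \<Rightarrow> int ^ 2 ^ 2 \<Rightarrow> complex" where
  "psi m A = (-1) powi (int m * A $ 2 $ 1 div 4)"

text \<open>No condition at the cusps is imposed: the functions considered have non-positive weight
  and in general a pole at the cusp \<open>0\<close>.\<close>

definition modular_form_Gamma0 ::
    "int \<Rightarrow> int \<Rightarrow> (int ^ 2 ^ 2 \<Rightarrow> complex) \<Rightarrow> (complex \<Rightarrow> complex) \<Rightarrow> bool" where
  "modular_form_Gamma0 N k ch f \<longleftrightarrow>
     f holomorphic_on upper_half_plane \<and>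
     (\<forall>A\<in>Gamma0 N. \<forall>\<tau>\<in>upper_half_plane.
        f (mat_act A \<tau>) = ch A * automorphy_factor A \<tau> powi k * f \<tau>)"

end

theory Submission
  imports Defs "HOL-Real_Asymp.Real_Asymp"
begin

text \<open>
  Both \<open>\<theta>(z; \<tau>)\<close> and \<open>sin (\<pi> z) exp (- \<Sum> q\<^sup>r (\<zeta>\<^sup>r + \<zeta>\<^sup>-\<^sup>r) / (r (1 - q\<^sup>r)))\<close> transform in the same
  way under \<open>z \<mapsto> z + 1\<close> and \<open>z \<mapsto> z + \<tau>\<close>, so by Liouville they are proportional; hence the zeros
  of \<open>\<theta>\<close> are simple and form the lattice \<open>\<int> + \<int>\<tau>\<close>, and \<open>\<phi>\<close> is an even elliptic function whose only pole
  modulo the lattice is \<open>0\<close>.  For odd \<open>N\<close> the elliptic function with Fourier expansion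
  \<open>\<Sum> r\<^sup>N \<zeta>\<^sup>r / (1 - q\<^sup>r)\<close> has principal part \<open>N! / (2 \<pi> \<i> z)\<^sup>N\<^sup>+\<^sup>1\<close> and an Eisenstein series as
  constant term.  Subtracting the right combination of these functions from \<open>\<phi>\<close> leaves an elliptic
  function without poles, i.e. a constant, which gives all \<open>\<chi>\<^sub>r\<close>.  For the modular behaviour,
  \<open>f(z; \<tau>) = \<theta>(z + 1/2; \<tau>) / \<theta>(z; \<tau>)\<close> is, up to a constant, the only function with simple poles on
  the lattice that is invariant under \<open>1\<close> and anti-invariant under \<open>\<tau>\<close>, so \<open>f(z / (c\<tau> + d); \<gamma>\<tau>) = \<kappa> f(z; \<tau>)\<close>; and
  \<open>f(z) f(z + 1/2) = - 1\<close> forces \<open>\<kappa>\<^sup>2 = (- 1)\<^sup>c\<^sup>/\<^sup>2\<close>.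
\<close>

section \<open>Elliptic functions on a strip and Fourier expansions\<close>

text \<open>The Lambert series to be compared with \<open>phi\<close> make sense only for |Im z| <
  Im tau, so each comparison lives on that strip and uses the shift by tau only for - Im tau < Im z
  < 0, where z and z + tau both lie in it. No contour integral around a fundamental cell occurs:
  constants are read off from limits at 0. The explicit product serves to locate the zeros of theta
  and their order at 0; the factor of proportionality is never computed. Likewise the sign of kappa
  stays undetermined, which is harmless because m is even and only kappa^2 enters. Two further tasks
  come from the form of the definitions. \<open>eisenstein_E\<close> divides by a Bernoulli number,
  so B_{2j} must be shown to be nonzero; this follows from a quadratic recurrence in which all terms
  have the same sign. And \<open>chi\<close> is a definite description, so Fourier expansions must
  be shown to be unique before any formula for \<open>chi\<close> is available.\<close>

lemma periodic_int_shift: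
  fixes f :: "complex \<Rightarrow> 'a"
  assumes "\<And>z. z \<in> A \<Longrightarrow> f (z + 1) = f z"
    and "\<And>z n. z \<in> A \<Longrightarrow> z + of_int n \<in> A"
    and "z \<in> A"
  shows "f (z + of_int n) = f z"
proof -
  have nat: "f (z + of_nat k) = f z" if "z \<in> A" for z k
  proof (induction k)
    case (Suc k)
    have "f (z + of_nat (Suc k)) = f (z + of_int (int k) + 1)" by (simp add: add_ac)
    also have "\<dots> = f (z + of_int (int k))" using assms(1) assms(2)[OF that] by blast
    finally show ?case using Suc by simp
  qed auto
  show ?thesis
  proof (cases "n \<ge> 0")
    case True
    then show ?thesis using nat[OF assms(3), of "nat n"] by simp
  next
    case False
    then show ?thesis using nat[OF assms(2)[OF assms(3), of n], of "nat (-n)"] by simp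
  qed
qed

lemma Ints_norm_less_1_imp_0:
  fixes z :: complex
  assumes "z \<in> \<int>" "norm z < 1"
  shows "z = 0"
proof -
  from assms(1) obtain n where n: "z = of_int n" by (auto elim: Ints_cases)
  with assms(2) have "\<bar>real_of_int n\<bar> < 1" by simp
  then have "n = 0" by linarith
  with n show ?thesis by simp
qed

lemma open_strip: "open {z. \<bar>Im z\<bar> < t}"
  by (intro open_Collect_less continuous_intros)

lemma convex_strip: "convex {z. \<bar>Im z\<bar> < t}"
proof -
  have "{z. \<bar>Im z\<bar> < t} = {z. Im z < t} \<inter> {z. Im z > -t}" by auto
  then show ?thesis
    by (auto intro!: convex_Int convex_halfspace_Im_lt convex_halfspace_Im_gt)
qed

lemma eventually_at_0_in_punctured_strip:
  assumes "0 < t"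
  shows "eventually (\<lambda>z. z \<in> {z. \<bar>Im z\<bar> < t} - \<int>) (at 0)"
proof -
  have "eventually (\<lambda>z. z \<in> {z. \<bar>Im z\<bar> < t} \<inter> ball 0 1 - {0}) (at 0)"
    using assms by (intro eventually_at_in_open open_Int open_strip) auto
  then show ?thesis by eventually_elim (use Ints_norm_less_1_imp_0 in auto)
qed

text \<open>
  A form of Liouville's theorem for elliptic functions that only needs the function on the strip
  \<open>\<bar>Im z\<bar> < Im \<tau>\<close>: every value is attained, up to modulus, on a compact rectangle in its interior.
\<close>

lemma quasi_elliptic_on_strip_constant:
  fixes f :: "complex \<Rightarrow> complex"
  defines "S \<equiv> \<lambda>t. {z. \<bar>Im z\<bar> < t}"
  assumes \<tau>: "0 < Im \<tau>"
    and hol: "f holomorphic_on (S (Im \<tau>) - \<int>)"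
    and per: "\<And>z. z \<in> S (Im \<tau>) - \<int> \<Longrightarrow> f (z + 1) = f z"
    and quasi: "\<And>z. - Im \<tau> < Im z \<Longrightarrow> Im z < 0 \<Longrightarrow> norm (f (z + \<tau>)) = norm (f z)"
    and lim: "((\<lambda>z. z * f z) \<longlongrightarrow> 0) (at 0)"
  obtains c where "\<And>z. z \<in> S (Im \<tau>) - \<int> \<Longrightarrow> f z = c"
proof -
  define T where "T = S (Im \<tau>)"
  have T_iff: "z \<in> T \<longleftrightarrow> \<bar>Im z\<bar> < Im \<tau>" for z by (simp add: T_def S_def)
  have oT: "open T" unfolding T_def S_def by (rule open_strip)
  have shiftT: "z + of_int n \<in> T - \<int>" if "z \<in> T - \<int>" for z n
    using that Ints_add[of "z + of_int n" "of_int (-n)"] by (auto simp: T_iff)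
  have per': "f (z + of_int n) = f z" if "z \<in> T - \<int>" for z n
    using per shiftT that unfolding T_def by (rule periodic_int_shift)
  define V where "V = T \<inter> ball 0 1"
  have oV: "open V" unfolding V_def using oT by auto
  have V0: "0 \<in> V" using \<tau> by (auto simp: V_def T_iff)
  have VT: "V - {0} \<subseteq> T - \<int>" using Ints_norm_less_1_imp_0 by (auto simp: V_def)
  \<comment> \<open>Riemann's theorem: since z f(z) tends to 0, the singularity at 0 is
    removable.\<close>
  have "\<exists>g. g holomorphic_on V \<and> (\<forall>z\<in>V - {0}. g z = f z)"
    using holomorphic_on_extend_lim[of f V 0] holomorphic_on_subset[OF hol[folded T_def] VT] oV V0 lim
    by (simp add: interior_open)
  then obtain g0 where g0: "g0 holomorphic_on V" "\<And>z. z \<in> V - {0} \<Longrightarrow> g0 z = f z" by blast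
  \<comment> \<open>By periodicity all integers are removable singularities with the same limit, so
    the value \<open>g0 0\<close> fills every one of them.\<close>
  define g where "g z = (if z \<in> \<int> then g0 0 else f z)" for z
  have g_near: "g z = g0 (z - of_int n)" if "z \<in> T" "norm (z - of_int n) < 1" for z n
  proof (cases "z = of_int n")
    case False
    then have "z - of_int n \<in> V - {0}" using that by (auto simp: V_def T_iff)
    moreover from this have "z - of_int n \<in> T - \<int>" using VT by blast
    moreover from this have "f (z - of_int n + of_int n) = f (z - of_int n)" by (rule per')
    moreover have "z \<notin> \<int>"
      using Ints_norm_less_1_imp_0[of "z - of_int n"] that False by (metis Ints_diff Ints_of_int eq_iff_diff_eq_0)
    ultimately show ?thesis using g0(2)[of "z - of_int n"] by (simp add: g_def)
  qed (auto simp: g_def)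
  have "g holomorphic_on T"
  proof (rule holomorphic_on_subset[OF analytic_imp_holomorphic])
    show "g analytic_on T"
    proof (subst analytic_on_analytic_at, rule ballI)
      fix z assume z: "z \<in> T"
      show "g analytic_on {z}"
      proof (cases "z \<in> \<int>")
        case False
        have "open (T - \<int>)" using oT by (intro open_Diff closed_Ints)
        moreover have "g holomorphic_on (T - \<int>)"
          using hol[folded T_def] by (rule holomorphic_transform) (auto simp: g_def)
        ultimately show ?thesis using z False
          unfolding analytic_at by blast
      next
        case True
        then obtain n where n: "z = of_int n" by (auto elim: Ints_cases)
        define W where "W = T \<inter> ball (of_int n) 1"
        have "open W" unfolding W_def using oT by auto
        moreover have "(\<lambda>z. g0 (z - of_int n)) holomorphic_on W"
          by (rule holomorphic_on_compose_gen[OF _ g0(1), unfolded o_def])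
             (auto intro!: holomorphic_intros simp: W_def V_def T_iff dist_norm norm_minus_commute)
        then have "g holomorphic_on W"
          by (rule holomorphic_transform) (auto simp: W_def g_near dist_norm norm_minus_commute)
        ultimately show ?thesis using z n
          unfolding analytic_at by (intro exI[of _ W]) (auto simp: W_def)
      qed
    qed
  qed auto
  \<comment> \<open>Half the height suffices: a point of the strip outside |Im z| <= Im tau / 2
    enters this range after one shift by tau, and unit shifts then bring it into K. So the maximum
    over K is a maximum over the open strip.\<close>
  define K where "K = cbox (Complex 0 (- Im \<tau> / 2)) (Complex 1 (Im \<tau> / 2))"
  have K_iff: "z \<in> K \<longleftrightarrow> 0 \<le> Re z \<and> Re z \<le> 1 \<and> \<bar>Im z\<bar> \<le> Im \<tau> / 2" for z
    by (auto simp: K_def in_cbox_complex_iff)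
  have KT: "K \<subseteq> T" using \<tau> by (auto simp: K_iff T_iff)
  have "compact K" "K \<noteq> {}" using \<tau> by (auto simp: K_def box_ne_empty Basis_complex_def)
  moreover have "continuous_on K (\<lambda>z. norm (g z))"
    using holomorphic_on_imp_continuous_on[OF holomorphic_on_subset[OF \<open>g holomorphic_on T\<close> KT]]
    by (intro continuous_intros)
  ultimately obtain \<xi> where \<xi>: "\<xi> \<in> K" "\<And>z. z \<in> K \<Longrightarrow> norm (g z) \<le> norm (g \<xi>)"
    using continuous_attains_sup[of K "\<lambda>z. norm (g z)"] by blast
  have g_per: "g (z + of_int n) = g z" if "z \<in> T" for z n
  proof (cases "z \<in> \<int>")
    case True then show ?thesis by (simp add: g_def)
  next
    case False
    then show ?thesis using per'[of z n] shiftT[of z n] that by (auto simp: g_def)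
  qed
  have bd: "norm (g z) \<le> norm (g \<xi>)" if "\<bar>Im z\<bar> \<le> Im \<tau> / 2" for z
  proof -
    have "z \<in> T" using that \<tau> by (auto simp: T_iff)
    then have "g z = g (z + of_int (- \<lfloor>Re z\<rfloor>))" by (rule g_per[symmetric])
    moreover have "z + of_int (- \<lfloor>Re z\<rfloor>) \<in> K" using that by (auto simp: K_iff) linarith
    ultimately show ?thesis using \<xi>(2) by metis
  qed
  have g_f: "g z = f z" if "Im z \<noteq> 0" for z
    using that by (auto simp: g_def elim!: Ints_cases)
  have "norm (g z) \<le> norm (g \<xi>)" if "z \<in> T" for z
  proof -
    consider "\<bar>Im z\<bar> \<le> Im \<tau> / 2" | "Im z > Im \<tau> / 2" | "Im z < - Im \<tau> / 2" by linarith
    then show ?thesis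
    proof cases
      case 2
      then have "norm (f ((z - \<tau>) + \<tau>)) = norm (f (z - \<tau>))"
        using that \<tau> by (intro quasi) (auto simp: T_iff)
      then have "norm (g z) = norm (g (z - \<tau>))" using 2 that \<tau> by (subst (1 2) g_f) (auto simp: T_iff)
      also have "\<dots> \<le> norm (g \<xi>)" using 2 that by (intro bd) (auto simp: T_iff)
      finally show ?thesis .
    next
      case 3
      then have "norm (f (z + \<tau>)) = norm (f z)"
        using that \<tau> by (intro quasi) (auto simp: T_iff)
      then have "norm (g z) = norm (g (z + \<tau>))" using 3 that \<tau> by (subst (1 2) g_f) (auto simp: T_iff)
      also have "\<dots> \<le> norm (g \<xi>)" using 3 that by (intro bd) (auto simp: T_iff)
      finally show ?thesis .
    qed (use bd in auto)
  qed
  then have "g constant_on T"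
    using \<xi>(1) KT oT convex_connected[OF convex_strip]
    by (intro maximum_modulus_principle[OF \<open>g holomorphic_on T\<close>, of T \<xi>]) (auto simp: T_def S_def)
  then obtain c where "\<And>z. z \<in> T \<Longrightarrow> g z = c" by (auto simp: constant_on_def)
  then have "f z = c" if "z \<in> S (Im \<tau>) - \<int>" for z using that by (force simp: g_def T_def)
  then show ?thesis using that by blast
qed

text \<open>Multiply by the exponential of index -r and integrate over one horizontal period. The
  modulus of each term depends only on the height y, so absolute summability at a single point gives
  a uniform majorant, and the net of finite partial sums may be integrated termwise.\<close>

lemma fourier_coefficients_zero:
  fixes a :: "int \<Rightarrow> complex"
  assumes "\<And>z. Im z = y \<Longrightarrow> ((\<lambda>r. a r * exp (2 * of_real pi * \<i> * z) powi r) has_sum 0) UNIV"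
  shows "a r = 0"
proof -
  define e where "e k x = exp (2 * of_real pi * \<i> * (of_real x + \<i> * of_real y)) powi k" for k :: int and x :: real
  have e_eq: "e k x = exp (2 * of_real pi * \<i> * of_int k * (of_real x + \<i> * of_real y))" for k x
    unfolding e_def exp_power_int by (simp add: mult_ac)
  have norm_e: "norm (e k x) = norm (e k 0)" for k x
    by (simp add: e_eq norm_exp_eq_Re algebra_simps)
  have sm: "((\<lambda>k. a k * e k x) has_sum 0) UNIV" for x
    unfolding e_def by (rule assms) simp
  have "(\<lambda>k. norm (a k * e k 0)) summable_on UNIV"
    using sm[of 0] by (metis has_sum_imp_summable summable_on_iff_abs_summable_on_complex)
  define f where "f k x = a k * e k x * e (-r) x" for k x
  have M: "(\<lambda>k. norm (a k * e k 0) * norm (e (-r) 0)) summable_on UNIV"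
    by (rule summable_on_cmult_left) fact
  have "uniform_limit {0..1} (\<lambda>X x. \<Sum>k\<in>X. f k x) (\<lambda>x. 0) (finite_subsets_at_top UNIV)"
  proof (rule Weierstrass_m_test_general'[OF _ _ M])
    show "norm (f k x) \<le> norm (a k * e k 0) * norm (e (-r) 0)" for k x
      by (simp add: f_def norm_mult norm_e[of _ x])
    show "((\<lambda>k. f k x) has_sum 0) UNIV" for x
      unfolding f_def using has_sum_cmult_left[OF sm[of x], of "e (-r) x"] by simp
  qed
  moreover have "continuous_on {0..1} (\<lambda>x. \<Sum>k\<in>X. f k x)" for X
    unfolding f_def e_eq by (intro continuous_intros)
  ultimately obtain I J where I: "\<And>X. ((\<lambda>x. \<Sum>k\<in>X. f k x) has_integral I X) {0..1}"
    and J: "((\<lambda>x. 0) has_integral J) {0..1::real}" and lim: "(I \<longlongrightarrow> J) (finite_subsets_at_top UNIV)"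
    by (rule uniform_limit_integral) auto
  have "J = 0" using J by (simp add: has_integral_0_eq)
  have f_int: "(f k has_integral (if k = r then a r else 0)) {0..1}" for k
  proof -
    define w where "w = 2 * of_real pi * \<i> * of_int (k - r)"
    have f_eq: "f k x = a k * exp (w * \<i> * of_real y) * exp (w * of_real x)" for x
      by (simp add: f_def e_eq w_def algebra_simps flip: exp_add)
    show ?thesis
    proof (cases "k = r")
      case True
      then have "f k = (\<lambda>x. a r)" using f_eq w_def
        by (auto simp: fun_eq_iff algebra_simps)
      then show ?thesis using True has_integral_const_real[of "a r" 0 1] by simp
    next
      case False
      then have w: "w \<noteq> 0" by (simp add: w_def)
      have "((\<lambda>x. exp (w * of_real x)) has_integral exp (w * of_real 1) / w - exp (w * of_real 0) / w) {0..1}"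
      proof (rule fundamental_theorem_of_calculus)
        fix x :: real assume "x \<in> {0..1}"
        have "((\<lambda>z. exp (w * z) / w) has_field_derivative exp (w * of_real x)) (at (of_real x))"
          using w by (auto intro!: derivative_eq_intros)
        then have "((\<lambda>x. exp (w * of_real x) / w) has_vector_derivative exp (w * of_real x)) (at x)"
          by (rule has_vector_derivative_real_field)
        then show "((\<lambda>x. exp (w * of_real x) / w) has_vector_derivative exp (w * of_real x)) (at x within {0..1})"
          by (rule has_vector_derivative_at_within)
      qed simp
      moreover have "exp w = 1"
        unfolding w_def using exp_integer_2pi[of "of_int (k - r)"] by (simp add: mult_ac)
      ultimately have "((\<lambda>x. exp (w * of_real x)) has_integral 0) {0..1}" by simp
      then have "((\<lambda>x. a k * exp (w * \<i> * of_real y) * exp (w * of_real x)) has_integral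
           a k * exp (w * \<i> * of_real y) * 0) {0..1}"
        by (rule has_integral_mult_right)
      then show ?thesis using False by (simp add: f_eq[abs_def])
    qed
  qed
  \<comment> \<open>As soon as the finite set X contains r, the integral of its partial sum is
    exactly \<open>a r\<close>, so the net \<open>I\<close> is eventually constant.\<close>
  have "I X = a r" if "finite X" "r \<in> X" for X
  proof -
    have "((\<lambda>x. \<Sum>k\<in>X. f k x) has_integral (\<Sum>k\<in>X. if k = r then a r else 0)) {0..1}"
      using that f_int by (intro has_integral_sum)
    then show ?thesis using has_integral_unique[OF I] that by simp
  qed
  then have "eventually (\<lambda>X. I X = a r) (finite_subsets_at_top UNIV)"
    unfolding eventually_finite_subsets_at_top by (intro exI[of _ "{r}"]) auto
  then have "(I \<longlongrightarrow> a r) (finite_subsets_at_top UNIV)" by (rule tendsto_eventually)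
  then show ?thesis using lim \<open>J = 0\<close> tendsto_unique finite_subsets_at_top_neq_bot by blast
qed

text \<open>The difference of two expansions is restricted to the middle line of the strip. This is
  what makes the definite description in \<open>chi\<close> denote.\<close>

lemma has_fourier_expansion_unique:
  assumes "has_fourier_expansion m \<tau> c" "has_fourier_expansion m \<tau> c'" "0 < Im \<tau>"
  shows "c = c'"
proof
  fix r
  have "((\<lambda>r. (c r - c' r) * exp (2 * of_real pi * \<i> * z) powi r) has_sum 0) UNIV"
    if "Im z = Im \<tau> / 2" for z
  proof -
    have "((\<lambda>r. c r * exp (2 * of_real pi * \<i> * z) powi r + - (c' r * exp (2 * of_real pi * \<i> * z) powi r))
            has_sum phi m z \<tau> + - phi m z \<tau>) UNIV"
      using that assms unfolding has_fourier_expansion_def by (intro has_sum_add) (auto simp: has_sum_uminus)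
    then show ?thesis by (simp add: algebra_simps)
  qed
  then show "c r = c' r" using fourier_coefficients_zero[of "Im \<tau> / 2" "\<lambda>r. c r - c' r" r] by simp
qed

section \<open>Jacobi's theta series\<close>

text \<open>Listing the negative integers as -1 - n realises the reflection nu -> - nu for nu = k +
  1/2, so both halves of a theta series have the same majorant.\<close>

lemma has_sum_int_split:
  fixes f :: "int \<Rightarrow> 'a :: {topological_comm_monoid_add, t2_space}"
  assumes "((\<lambda>n. f (int n)) has_sum a) UNIV" "((\<lambda>n. f (- 1 - int n)) has_sum b) UNIV"
  shows "(f has_sum (a + b)) UNIV"
proof -
  have "(f has_sum a) (range int)"
    using assms(1) by (subst has_sum_reindex) (auto simp: o_def)
  moreover have "(f has_sum b) (range (\<lambda>n. - 1 - int n))"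
    using assms(2) by (subst has_sum_reindex) (auto simp: o_def inj_on_def)
  moreover have "range int \<inter> range (\<lambda>n. - 1 - int n) = {}" by auto
  moreover have "range int \<union> range (\<lambda>n. - 1 - int n) = UNIV"
  proof -
    have "k \<in> range int \<union> range (\<lambda>n. - 1 - int n)" for k
    proof (cases "k \<ge> 0")
      case False
      then have "k = - 1 - int (nat (- 1 - k))" by simp
      then show ?thesis by blast
    qed (metis UnI1 nat_0_le rangeI)
    then show ?thesis by blast
  qed
  ultimately show ?thesis using has_sum_Un_disjoint by metis
qed

lemma summable_on_int_split:
  fixes f :: "int \<Rightarrow> 'a :: {topological_comm_monoid_add, t2_space}"
  assumes "(\<lambda>n. f (int n)) summable_on UNIV" "(\<lambda>n. f (- 1 - int n)) summable_on UNIV"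
  shows "f summable_on UNIV"
  using assms has_sum_int_split unfolding summable_on_def by blast

text \<open>The power is what n differentiations in z bring down from the exponential; one estimate
  then covers theta and all its derivatives.\<close>

definition theta_term :: "nat \<Rightarrow> int \<Rightarrow> complex \<Rightarrow> complex \<Rightarrow> complex" where
  "theta_term n k z \<tau> = (2 * of_real pi * \<i> * (of_int k + 1/2)) ^ n *
     exp (of_real pi * \<i> * (of_int k + 1/2)\<^sup>2 * \<tau> + 2 * of_real pi * \<i> * (of_int k + 1/2) * (z + 1/2))"

definition theta_deriv :: "nat \<Rightarrow> complex \<Rightarrow> complex \<Rightarrow> complex" where
  "theta_deriv n z \<tau> = (\<Sum>\<^sub>\<infinity>k. theta_term n k z \<tau>)"

lemma jacobi_theta_altdef: "jacobi_theta z \<tau> = (\<Sum>\<^sub>\<infinity>k. theta_term 0 k z \<tau>)"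
  by (simp add: jacobi_theta_def theta_term_def Let_def)

lemma theta_deriv_0: "theta_deriv 0 z \<tau> = jacobi_theta z \<tau>"
  by (simp add: theta_deriv_def jacobi_theta_altdef)

text \<open>The majorant is uniform over norm z <= R and Im tau >= epsilon, so z may vary at fixed
  tau as well as tau at fixed z.\<close>

definition theta_bound :: "nat \<Rightarrow> real \<Rightarrow> real \<Rightarrow> int \<Rightarrow> real" where
  "theta_bound n R \<epsilon> k = (2 * pi * \<bar>of_int k + 1/2\<bar>) ^ n *
     exp (- (pi * (of_int k + 1/2)\<^sup>2 * \<epsilon>) + 2 * pi * \<bar>of_int k + 1/2\<bar> * R)"

lemma norm_theta_term_le:
  assumes "norm z \<le> R" "Im \<tau> \<ge> \<epsilon>"
  shows "norm (theta_term n k z \<tau>) \<le> theta_bound n R \<epsilon> k"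
proof -
  define v where "v = real_of_int k + 1/2"
  have v: "of_int k + 1/2 = complex_of_real v" by (simp add: v_def)
  have "norm (theta_term n k z \<tau>) = (2 * pi * \<bar>v\<bar>) ^ n * exp (- (pi * v\<^sup>2 * Im \<tau>) - 2 * pi * v * Im z)"
    unfolding theta_term_def v by (simp add: norm_mult norm_power power2_eq_square)
  also have "\<dots> \<le> (2 * pi * \<bar>v\<bar>) ^ n * exp (- (pi * v\<^sup>2 * \<epsilon>) + 2 * pi * \<bar>v\<bar> * R)"
  proof -
    have "pi * v\<^sup>2 * \<epsilon> \<le> pi * v\<^sup>2 * Im \<tau>" using assms by (intro mult_left_mono) auto
    moreover have "- (v * Im z) \<le> \<bar>v\<bar> * \<bar>Im z\<bar>" by (simp flip: abs_mult)
    moreover have "\<bar>v\<bar> * \<bar>Im z\<bar> \<le> \<bar>v\<bar> * R"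
      using abs_Im_le_cmod[of z] assms by (intro mult_left_mono) auto
    ultimately have "- (pi * v\<^sup>2 * Im \<tau>) + 2 * pi * (- (v * Im z)) \<le> - (pi * v\<^sup>2 * \<epsilon>) + 2 * pi * (\<bar>v\<bar> * R)"
      by (intro add_mono mult_left_mono) auto
    then show ?thesis by (intro mult_left_mono) (auto simp: mult_ac)
  qed
  finally show ?thesis by (simp add: theta_bound_def v_def)
qed

text \<open>By x^n <= n! exp x the polynomial factor only replaces R by R + 1, and the Gaussian
  decay in k + 1/2 dominates the remaining linear exponent.\<close>

lemma theta_bound_summable:
  assumes "\<epsilon> > 0"
  shows "theta_bound n R \<epsilon> summable_on UNIV"
proof -
  define g where "g j = theta_bound n R \<epsilon> (int j)" for j
  have le: "g j \<le> fact n * exp (- (pi * \<epsilon>) * (real j + 1/2)\<^sup>2 + (2 * pi * (R + 1)) * (real j + 1/2))" for j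
  proof -
    have "x ^ n \<le> fact n * exp x" if "x \<ge> 0" for x :: real
    proof -
      have "x ^ n /\<^sub>R fact n \<le> exp x"
        unfolding exp_def using summable_exp_generic[of x] that
        by (intro order_trans[OF _ sum_le_suminf[of _ "{n}"]]) auto
      then show ?thesis by (simp add: field_simps)
    qed
    then have "(2 * pi * \<bar>real j + 1/2\<bar>) ^ n \<le> fact n * exp (2 * pi * \<bar>real j + 1/2\<bar>)" by simp
    then have "g j \<le> fact n * exp (2 * pi * \<bar>real j + 1/2\<bar>) *
        exp (- (pi * (real j + 1/2)\<^sup>2 * \<epsilon>) + 2 * pi * \<bar>real j + 1/2\<bar> * R)"
      unfolding g_def theta_bound_def of_int_of_nat_eq by (intro mult_right_mono) auto
    also have "\<dots> = fact n * exp (- (pi * \<epsilon>) * (real j + 1/2)\<^sup>2 + (2 * pi * (R + 1)) * (real j + 1/2))"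
      by (simp add: mult.assoc flip: exp_add) (simp add: algebra_simps)
    finally show ?thesis .
  qed
  have nn: "g j \<ge> 0" for j by (simp add: g_def theta_bound_def)
  have "summable g"
  proof (rule summable_comparison_test_bigo)
    show "summable (\<lambda>j. norm (exp (-1 :: real) ^ j))" by (simp add: summable_geometric)
    define a where "a = pi * \<epsilon>"
    define b where "b = 2 * pi * (R + 1)"
    have "a > 0" using assms by (simp add: a_def)
    then have "(\<lambda>j. exp (- a * (real j + 1/2)\<^sup>2 + b * (real j + 1/2))) \<in> O(\<lambda>j. exp (- real j))"
      by real_asymp
    moreover have "g \<in> O(\<lambda>j. exp (- a * (real j + 1/2)\<^sup>2 + b * (real j + 1/2)))"
      by (rule bigoI[of _ "fact n"]) (use le nn in \<open>auto simp: a_def b_def\<close>)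
    moreover have "exp (-1) ^ j = exp (- real j)" for j by (simp flip: exp_of_nat_mult)
    ultimately show "g \<in> O(\<lambda>j. exp (-1) ^ j)" using landau_o.big_trans by force
  qed
  then have "g summable_on UNIV" using nn by (simp add: summable_on_UNIV_nonneg_real_iff)
  moreover have "theta_bound n R \<epsilon> (- 1 - int j) = g j" for j
  proof -
    have "real_of_int (- 1 - int j) + 1/2 = - (real_of_int (int j) + 1/2)" by simp
    then show ?thesis unfolding g_def theta_bound_def by (simp only: abs_minus_cancel power2_minus)
  qed
  ultimately show ?thesis by (intro summable_on_int_split) (simp_all add: g_def[abs_def])
qed

lemma theta_term_has_sum:
  assumes "Im \<tau> > 0"
  shows "((\<lambda>k. theta_term n k z \<tau>) has_sum theta_deriv n z \<tau>) UNIV"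
proof -
  have "(\<lambda>k. theta_term n k z \<tau>) summable_on UNIV"
    by (rule abs_summable_summable, rule summable_on_comparison_test[OF theta_bound_summable[OF assms]])
       (auto intro: norm_theta_term_le[of z "norm z"])
  then show ?thesis unfolding theta_deriv_def by (rule has_sum_infsum)
qed

lemma theta_deriv_has_field_derivative:
  assumes "Im \<tau> > 0"
  shows "((\<lambda>z. theta_deriv n z \<tau>) has_field_derivative theta_deriv (Suc n) z \<tau>) (at z)"
proof -
  have ul: "uniform_limit (cball z 1) (\<lambda>X z. \<Sum>k\<in>X. theta_term n k z \<tau>) (\<lambda>z. theta_deriv n z \<tau>)
      (finite_subsets_at_top UNIV)"
  proof (rule Weierstrass_m_test_general'[OF _ _ theta_bound_summable[OF assms]])
    fix k w assume "w \<in> cball z 1"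
    then have "norm w \<le> norm z + 1"
      by (smt (verit) dist_norm mem_cball norm_minus_commute norm_triangle_ineq2)
    then show "norm (theta_term n k w \<tau>) \<le> theta_bound n (norm z + 1) (Im \<tau>) k"
      by (rule norm_theta_term_le) simp
  qed (rule theta_term_has_sum[OF assms])
  have der: "((\<lambda>z. \<Sum>k\<in>X. theta_term n k z \<tau>) has_field_derivative (\<Sum>k\<in>X. theta_term (Suc n) k w \<tau>)) (at w)"
    for X w
    unfolding theta_term_def by (intro DERIV_sum) (auto intro!: derivative_eq_intros simp: mult_ac)
  have cont: "continuous_on A (\<lambda>z. \<Sum>k\<in>X. theta_term n k z \<tau>)" for A X
    by (rule DERIV_continuous_on) (rule has_field_derivative_at_within, rule der)
  obtain g' where
    g': "\<And>w. w \<in> ball z 1 \<Longrightarrow> ((\<lambda>z. theta_deriv n z \<tau>) has_field_derivative g' w) (at w) \<and>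
         ((\<lambda>X. \<Sum>k\<in>X. theta_term (Suc n) k w \<tau>) \<longlongrightarrow> g' w) (finite_subsets_at_top UNIV)"
    by (rule has_complex_derivative_uniform_limit[of z 1 "\<lambda>X z. \<Sum>k\<in>X. theta_term n k z \<tau>"
        "\<lambda>X z. \<Sum>k\<in>X. theta_term (Suc n) k z \<tau>" "finite_subsets_at_top UNIV"
        "\<lambda>z. theta_deriv n z \<tau>", OF always_eventually ul finite_subsets_at_top_neq_bot]) (use der cont in auto)
  have "((\<lambda>k. theta_term (Suc n) k z \<tau>) has_sum g' z) UNIV"
    using g'[of z] by (simp add: has_sum_def)
  then have "g' z = theta_deriv (Suc n) z \<tau>"
    using theta_term_has_sum[OF assms] has_sum_unique by blast
  then show ?thesis using g'[of z] by simp
qed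

text \<open>Holomorphy in the modular variable at fixed z, from which that of the functions
  \<open>D\<close> is deduced. A ball of radius Im tau / 2 stays above that height, where one
  majorant works.\<close>

lemma theta_deriv_holomorphic:
  shows "theta_deriv n z holomorphic_on upper_half_plane"
proof (rule analytic_imp_holomorphic, subst analytic_on_analytic_at, rule ballI)
  fix \<tau> :: complex assume "\<tau> \<in> upper_half_plane"
  define e where "e = Im \<tau> / 2"
  have e: "e > 0" using \<open>\<tau> \<in> _\<close> by (simp add: e_def)
  have Im_ge: "Im w \<ge> e" if "w \<in> cball \<tau> e" for w
  proof -
    have "\<bar>Im (\<tau> - w)\<bar> \<le> e" using abs_Im_le_cmod[of "\<tau> - w"] that by (auto simp: dist_norm)
    then show ?thesis unfolding e_def minus_complex.sel by linarith
  qed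
  have ul: "uniform_limit (cball \<tau> e) (\<lambda>X w. \<Sum>k\<in>X. theta_term n k z w) (\<lambda>w. theta_deriv n z w)
      (finite_subsets_at_top UNIV)"
  proof (rule Weierstrass_m_test_general'[OF _ _ theta_bound_summable[OF e]])
    show "norm (theta_term n k z w) \<le> theta_bound n (norm z) e k" if "w \<in> cball \<tau> e" for k w
      using Im_ge[OF that] by (intro norm_theta_term_le) auto
    show "((\<lambda>k. theta_term n k z w) has_sum theta_deriv n z w) UNIV" if "w \<in> cball \<tau> e" for w
      using Im_ge[OF that] e by (intro theta_term_has_sum) auto
  qed
  have hol: "(\<lambda>w. \<Sum>k\<in>X. theta_term n k z w) holomorphic_on A" for X A
    unfolding theta_term_def by (intro holomorphic_intros)
  have "theta_deriv n z holomorphic_on ball \<tau> e"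
    by (rule holomorphic_uniform_limit[of \<tau> e "\<lambda>X w. \<Sum>k\<in>X. theta_term n k z w"
        "finite_subsets_at_top UNIV" "theta_deriv n z", OF always_eventually ul finite_subsets_at_top_neq_bot])
       (use hol in \<open>auto intro: holomorphic_on_imp_continuous_on\<close>)
  then show "theta_deriv n z analytic_on {\<tau>}"
    unfolding analytic_at using e by (intro exI[of _ "ball \<tau> e"]) auto
qed

lemma jacobi_theta_holomorphic:
  assumes "Im \<tau> > 0"
  shows "(\<lambda>z. jacobi_theta z \<tau>) holomorphic_on A"
  using theta_deriv_has_field_derivative[OF assms, of 0] unfolding theta_deriv_0
  by (auto simp: holomorphic_on_def field_differentiable_def intro: has_field_derivative_at_within)

section \<open>Functional equations of theta in z\<close>

lemma exp_two_pi_i_half_int: "exp (2 * of_real pi * \<i> * (of_int k + 1/2)) = -1"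
proof -
  have "exp (2 * of_real pi * \<i> * (of_int k + 1/2)) = exp (2 * pi * \<i> * of_int k) * exp (of_real pi * \<i>)"
    by (simp add: algebra_simps flip: exp_add)
  then show ?thesis using exp_integer_2pi[of "of_int k"] by (simp add: mult_ac)
qed

lemma jacobi_theta_plus_1: "jacobi_theta (z + 1) \<tau> = - jacobi_theta z \<tau>"
proof -
  have "theta_term 0 k (z + 1) \<tau> = - theta_term 0 k z \<tau>" for k
  proof -
    have "theta_term 0 k (z + 1) \<tau> = theta_term 0 k z \<tau> * exp (2 * of_real pi * \<i> * (of_int k + 1/2))"
      unfolding theta_term_def power_0 mult_1 exp_add[symmetric]
      by (rule arg_cong[where f = exp]) (simp add: field_simps)
    then show ?thesis unfolding exp_two_pi_i_half_int by simp
  qed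
  then show ?thesis unfolding jacobi_theta_altdef by (simp add: infsum_uminus)
qed

lemma jacobi_theta_uminus: "jacobi_theta (- z) \<tau> = - jacobi_theta z \<tau>"
proof -
  have "theta_term 0 (- 1 - k) (- z) \<tau> = - theta_term 0 k z \<tau>" for k
  proof -
    have "theta_term 0 (- 1 - k) (- z) \<tau> = theta_term 0 k z \<tau> * exp (- (2 * of_real pi * \<i> * (of_int k + 1/2)))"
      unfolding theta_term_def by (simp add: algebra_simps power2_eq_square flip: exp_add)
    also have "exp (- (2 * of_real pi * \<i> * (of_int k + 1/2))) = -1"
      using exp_two_pi_i_half_int[of k] by (simp only: exp_minus) simp
    finally show ?thesis by simp
  qed
  moreover have "(\<Sum>\<^sub>\<infinity>k. theta_term 0 (- 1 - k) (- z) \<tau>) = (\<Sum>\<^sub>\<infinity>k. theta_term 0 k (- z) \<tau>)"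
    by (rule infsum_reindex_bij_betw[of "\<lambda>k. - 1 - k"]) (auto intro!: bij_betwI[of _ _ _ "\<lambda>k. - 1 - k"])
  ultimately show ?thesis unfolding jacobi_theta_altdef by (simp add: infsum_uminus)
qed

text \<open>Completing the square, nu^2 tau + 2 nu tau = (nu + 1)^2 tau - tau, turns translation by
  tau into a shift of the summation index; the sign comes from the 1/2 in z + 1/2.\<close>

lemma jacobi_theta_plus_tau:
  "jacobi_theta (z + \<tau>) \<tau> = - exp (- (of_real pi * \<i> * \<tau>) - 2 * of_real pi * \<i> * z) * jacobi_theta z \<tau>"
proof -
  define c where "c = - exp (- (of_real pi * \<i> * \<tau>) - 2 * of_real pi * \<i> * z)"
  have "theta_term 0 k (z + \<tau>) \<tau> = c * theta_term 0 (k + 1) z \<tau>" for k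
  proof -
    have "c = exp (- (of_real pi * \<i> * \<tau>) - 2 * of_real pi * \<i> * z - of_real pi * \<i>)"
      unfolding c_def by (simp add: exp_diff)
    then show ?thesis
      unfolding theta_term_def by (simp add: algebra_simps power2_eq_square flip: exp_add)
  qed
  moreover have "(\<Sum>\<^sub>\<infinity>k. theta_term 0 (k + 1) z \<tau>) = (\<Sum>\<^sub>\<infinity>k. theta_term 0 k z \<tau>)"
    by (rule infsum_reindex_bij_betw[of "\<lambda>k. k + 1"]) (auto intro!: bij_betwI[of _ _ _ "\<lambda>k. k - 1"])
  ultimately show ?thesis unfolding jacobi_theta_altdef by (simp only: infsum_cmult_right' flip: c_def)
qed

lemma jacobi_theta_0: "jacobi_theta 0 \<tau> = 0"
  using jacobi_theta_uminus[of 0 \<tau>] by simp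

section \<open>Lambert series and the derivatives of \<open>1 / (1 - exp s)\<close>\<close>

lemma summable_of_nat_power_mult_power:
  fixes x :: "'a :: {real_normed_field, banach}"
  assumes "norm x < 1"
  shows "summable (\<lambda>r. of_nat r ^ N * x ^ r)"
  using assms
proof (induction N arbitrary: x)
  case (Suc N)
  have "summable (\<lambda>r. diffs (\<lambda>r. of_nat r ^ N) r * x ^ r)"
    by (rule termdiff_converges[of x 1]) (use Suc in auto)
  then have "summable (\<lambda>r. x * (of_nat (Suc r) ^ Suc N * x ^ r))"
    by (intro summable_mult) (simp add: diffs_def mult_ac)
  then have "summable (\<lambda>r. of_nat (Suc r) ^ Suc N * x ^ Suc r)"
    by (simp add: mult_ac)
  then show ?case by (rule summable_Suc_iff[THEN iffD1])
qed (simp add: summable_geometric)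

text \<open>For Re s < 0 this is the sum of exp (r s) over r >= 0; the closed form continues that
  part of the Fourier series across Im z = 0, where the series diverges. It is also - 1/s times the
  generating function of the Bernoulli numbers, which is how they enter the constant terms.\<close>

definition bose :: "complex \<Rightarrow> complex" where
  "bose s = 1 / (1 - exp s)"

lemma bose_deriv_sums:
  assumes "Re s < 0"
  shows "(\<lambda>r. of_nat r ^ N * exp s ^ r) sums (deriv ^^ N) bose s"
  using assms
proof (induction N arbitrary: s)
  case 0
  then show ?case using geometric_sums[of "exp s"] by (simp add: bose_def)
next
  case (Suc N)
  define F where "F w = (\<Sum>r. of_nat r ^ N * w ^ r :: complex)" for w
  define F' where "F' w = (\<Sum>r. diffs (\<lambda>r. of_nat r ^ N) r * w ^ r :: complex)" for w
  have "norm (exp s) < 1" using Suc.prems by simp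
  then have "(F has_field_derivative F' (exp s)) (at (exp s))" unfolding F_def F'_def
    using summable_of_nat_power_mult_power[of _ N] by (intro termdiffs_strong'[of 1]) auto
  then have "((\<lambda>s. F (exp s)) has_field_derivative F' (exp s) * exp s) (at s)"
    by (intro DERIV_chain2) auto
  then have "((deriv ^^ N) bose has_field_derivative F' (exp s) * exp s) (at s)"
  proof (rule has_field_derivative_transform_within_open)
    show "open {s. Re s < 0}" by (simp add: open_halfspace_Re_lt)
    show "F (exp t) = (deriv ^^ N) bose t" if "t \<in> {s. Re s < 0}" for t
      using Suc.IH[of t] that by (simp add: F_def sums_iff)
  qed (use Suc.prems in auto)
  then have eq: "(deriv ^^ Suc N) bose s = F' (exp s) * exp s"
    by (simp add: DERIV_imp_deriv)
  have "summable (\<lambda>r. diffs (\<lambda>r. of_nat r ^ N) r * exp s ^ r :: complex)"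
    using \<open>norm (exp s) < 1\<close> summable_of_nat_power_mult_power[of _ N]
    by (intro termdiff_converges[of _ 1]) auto
  then have "(\<lambda>r. diffs (\<lambda>r. of_nat r ^ N) r * exp s ^ r) sums F' (exp s)"
    unfolding F'_def by (rule summable_sums)
  then have "(\<lambda>r. diffs (\<lambda>r. of_nat r ^ N) r * exp s ^ r * exp s) sums (F' (exp s) * exp s)"
    by (rule sums_mult2)
  then have "(\<lambda>r. of_nat (Suc r) ^ Suc N * exp s ^ Suc r) sums (F' (exp s) * exp s)"
    by (simp add: diffs_def mult_ac)
  \<comment> \<open>The differentiated series starts at index 1; the missing term at 0 is
    \<open>0 ^ Suc N\<close>, which is 0.\<close>
  then show ?case
    using sums_Suc_iff[of "\<lambda>r. of_nat r ^ Suc N * exp s ^ r :: complex" "F' (exp s) * exp s"]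
    unfolding eq by simp
qed

lemma bose_analytic: "exp s \<noteq> 1 \<Longrightarrow> bose analytic_on {s}"
  unfolding bose_def by (auto intro!: analytic_intros)

lemma higher_deriv_bose_analytic: "exp s \<noteq> 1 \<Longrightarrow> (deriv ^^ N) bose analytic_on {s}"
  by (intro analytic_higher_deriv bose_analytic)

lemma bose_uminus: "exp s \<noteq> 1 \<Longrightarrow> bose (- s) = 1 - bose s"
  by (simp add: bose_def exp_minus field_simps)

text \<open>Differentiating \<open>bose (- s) = 1 - bose s\<close> at least once removes the
  constant. For odd N the derivative is even, which lets the positive and negative frequencies of
  \<open>elliptic_series\<close> fit together.\<close>

lemma higher_deriv_bose_uminus:
  assumes "exp s \<noteq> 1" "N > 0"
  shows "(deriv ^^ N) bose (- s) = (-1) ^ Suc N * (deriv ^^ N) bose s"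
proof -
  have "closed {s::complex. exp s = 1}"
    by (intro closed_Collect_eq continuous_intros)
  then have opn: "open {s::complex. exp s \<noteq> 1}" by (simp add: open_closed Compl_eq)
  have hol: "bose holomorphic_on {s. exp s \<noteq> 1}"
    unfolding bose_def by (intro holomorphic_intros) auto
  have neg: "exp (- t) \<noteq> 1" if "exp t \<noteq> 1" for t :: complex
    using that by (metis exp_minus minus_minus inverse_1)
  have "(deriv ^^ N) (\<lambda>s. bose ((- 1) * s)) s = (- 1) ^ N * (deriv ^^ N) bose ((- 1) * s)"
    by (rule higher_deriv_compose_linear[OF hol opn opn]) (use assms neg in auto)
  moreover have "(deriv ^^ N) (\<lambda>s. bose ((- 1) * s)) s = (deriv ^^ N) (\<lambda>s. 1 - bose s) s"
    by (rule higher_deriv_transform_within_open[OF _ _ opn])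
       (use assms neg bose_uminus in \<open>auto intro!: holomorphic_intros simp: bose_def\<close>)
  moreover have "(deriv ^^ N) (\<lambda>s. 1 - bose s) s = (deriv ^^ N) (\<lambda>s. 1) s - (deriv ^^ N) bose s"
    by (rule higher_deriv_diff[OF _ hol opn]) (use assms in auto)
  moreover have "(deriv ^^ N) (\<lambda>s. 1 :: complex) s = 0"
    using assms by (simp add: higher_deriv_const)
  ultimately have "- (deriv ^^ N) bose s = (- 1) ^ N * (deriv ^^ N) bose (- s)" by simp
  then have "(- 1) ^ N * (- (deriv ^^ N) bose s) = (- 1) ^ N * (- 1) ^ N * (deriv ^^ N) bose (- s)"
    by simp
  also have "(- 1) ^ N * (- 1 :: complex) ^ N = 1" by (simp flip: power_mult_distrib)
  finally show ?thesis by simp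
qed

text \<open>In 1 / (1 - q^r) = 1 + q^r / (1 - q^r) this is the contribution of the second summand.
  For polynomially bounded b it converges for norm w < 1 / norm q and not just for norm w < 1. The
  term r = 0 has denominator 0 and so equals 0.\<close>

definition lambert :: "(nat \<Rightarrow> complex) \<Rightarrow> complex \<Rightarrow> complex \<Rightarrow> complex" where
  "lambert b q w = (\<Sum>r. b r * q ^ r / (1 - q ^ r) * w ^ r)"

context
  fixes b :: "nat \<Rightarrow> complex" and q :: complex and N :: nat
  assumes q: "norm q < 1" and b0: "b 0 = 0" and b: "\<And>r. norm (b r) \<le> of_nat r ^ N"
begin

lemma norm_lambert_term_le:
  "norm (b r * q ^ r / (1 - q ^ r) * w ^ r) \<le> inverse (1 - norm q) * (of_nat r ^ N * norm (q * w) ^ r)"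
proof (cases "r = 0")
  case False
  have "norm q ^ r \<le> norm q" using power_decreasing[of 1 r "norm q"] q False by simp
  then have "1 - norm q \<le> norm (1 - q ^ r)"
    using norm_triangle_ineq2[of 1 "q ^ r"] by (simp add: norm_power)
  then have "inverse (norm (1 - q ^ r)) \<le> inverse (1 - norm q)" using q by (intro le_imp_inverse_le) auto
  then have "norm (b r) * norm (q * w) ^ r * inverse (norm (1 - q ^ r)) \<le>
        of_nat r ^ N * norm (q * w) ^ r * inverse (1 - norm q)"
    using b by (intro mult_mono) auto
  then show ?thesis by (simp add: norm_mult norm_divide norm_power power_mult_distrib field_simps)
qed (use b0 q in auto)

lemma lambert_summable_norm:
  assumes "norm (q * w) < 1"
  shows "summable (\<lambda>r. norm (b r * q ^ r / (1 - q ^ r) * w ^ r))"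
proof (rule summable_comparison_test'[where N = 0])
  show "summable (\<lambda>r. inverse (1 - norm q) * (of_nat r ^ N * norm (q * w) ^ r))"
    using assms by (intro summable_mult summable_of_nat_power_mult_power) simp
  show "norm (norm (b r * q ^ r / (1 - q ^ r) * w ^ r)) \<le>
      inverse (1 - norm q) * (of_nat r ^ N * norm (q * w) ^ r)" for r
    using norm_lambert_term_le[of r w] by simp
qed

lemma lambert_sums:
  "norm (q * w) < 1 \<Longrightarrow> (\<lambda>r. b r * q ^ r / (1 - q ^ r) * w ^ r) sums lambert b q w"
  unfolding lambert_def by (rule summable_sums, rule summable_norm_cancel, rule lambert_summable_norm)

lemma lambert_holomorphic: "lambert b q holomorphic_on {w. norm (q * w) < 1}"
proof (cases "q = 0")
  case True
  have "b r * q ^ r = 0" for r using True b0 by (cases "r = 0") auto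
  then have "lambert b q = (\<lambda>w. 0)" unfolding lambert_def by (simp only: div_0 mult_zero_left suminf_zero)
  then show ?thesis by simp
next
  case False
  then have "{w. norm (q * w) < 1} = ball 0 (inverse (norm q))"
    by (auto simp: norm_mult field_simps)
  moreover have "lambert b q holomorphic_on ball 0 (inverse (norm q))"
    using lambert_sums False
    by (intro power_series_holomorphic[where a = "\<lambda>r. b r * q ^ r / (1 - q ^ r)"])
       (simp add: norm_mult field_simps)
  ultimately show ?thesis by simp
qed

text \<open>Passing from w to q w multiplies the r-th term by q^r, so the difference cancels the
  denominator. With w = zeta this is translation by tau: for b r = 1/r the difference is a
  logarithm, for b r = r^N a derivative of \<open>bose\<close>.\<close>

lemma lambert_functional_equation:
  assumes "norm (q * w) < 1"
  shows "(\<lambda>r. b r * (q * w) ^ r) sums (lambert b q w - lambert b q (q * w))"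
proof -
  have "norm (q * (q * w)) < 1"
    using mult_strict_mono'[of "norm q" 1 "norm (q * w)" 1] q assms by (simp add: norm_mult)
  then have *: "(\<lambda>r. b r * q ^ r / (1 - q ^ r) * w ^ r - b r * q ^ r / (1 - q ^ r) * (q * w) ^ r)
     sums (lambert b q w - lambert b q (q * w))"
    using assms by (intro sums_diff lambert_sums)
  have "b r * q ^ r / (1 - q ^ r) * w ^ r - b r * q ^ r / (1 - q ^ r) * (q * w) ^ r = b r * (q * w) ^ r" for r
  proof (cases "r = 0")
    case False
    have "norm (q ^ r) < 1" using q False by (simp add: norm_power power_less_one_iff)
    then have "1 - q ^ r \<noteq> 0" by auto
    have "x * q ^ r / (1 - q ^ r) * y - x * q ^ r / (1 - q ^ r) * (q ^ r * y) = x * (q ^ r * y)" for x y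
    proof -
      have "x * q ^ r / (1 - q ^ r) * y - x * q ^ r / (1 - q ^ r) * (q ^ r * y) =
          x * q ^ r / (1 - q ^ r) * ((1 - q ^ r) * y)"
        by (simp only: left_diff_distrib right_diff_distrib mult_1)
      then show ?thesis using \<open>1 - q ^ r \<noteq> 0\<close> by simp
    qed
    then show ?thesis by (simp only: power_mult_distrib)
  qed (use b0 in auto)
  then show ?thesis using * by simp
qed

end

lemma geometric_multiples_has_sum:
  fixes x :: "'a :: {real_normed_field, banach}"
  assumes "norm x < 1" "r > 0"
  shows "((\<lambda>d. c * x ^ (r * d)) has_sum (c * x ^ r / (1 - x ^ r))) {1..}"
proof -
  have lt: "norm (x ^ r) < 1" using assms by (simp add: norm_power power_less_one_iff)
  have "((\<lambda>d. (x ^ r) ^ d) has_sum (1 / (1 - x ^ r))) UNIV"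
    using lt by (intro norm_summable_imp_has_sum geometric_sums) (simp_all add: norm_power)
  then have "((\<lambda>d. c * x ^ r * (x ^ r) ^ d) has_sum (c * x ^ r * (1 / (1 - x ^ r)))) UNIV"
    by (rule has_sum_cmult_right)
  then have "((\<lambda>d. c * x ^ (r * Suc d)) has_sum (c * x ^ r / (1 - x ^ r))) UNIV"
    by (simp add: power_mult power_add mult.assoc)
  then have "((\<lambda>d. c * x ^ (r * d)) has_sum (c * x ^ r / (1 - x ^ r))) (range Suc)"
    by (subst has_sum_reindex) (auto simp: o_def)
  also have "range Suc = {1..}" by (auto simp: image_iff) (metis Suc_le_D)
  finally show ?thesis .
qed

text \<open>Expand q^r / (1 - q^r) as a geometric series in q^(r d) and collect the pairs with r d =
  l; absolute summability over all pairs permits the regrouping. This is how the Eisenstein series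
  appears as a constant term.\<close>

lemma lambert_eq_divisor_sum:
  assumes q: "norm q < 1" and N: "N > 0"
  shows "((\<lambda>l. of_nat (divisor_power_sum N l) * q ^ l) has_sum lambert (\<lambda>r. of_nat r ^ N) q 1) {1..}"
proof -
  define f where "f = (\<lambda>(r, d). of_nat r ^ N * q ^ (r * d))"
  define g where "g r = of_nat r ^ N * q ^ r / (1 - q ^ r)" for r
  have g0: "g 0 = 0" using N by (simp add: g_def)
  have "norm (of_nat r ^ N :: complex) \<le> of_nat r ^ N" for r by (simp add: norm_power)
  then have lam: "g sums lambert (\<lambda>r. of_nat r ^ N) q 1" "summable (\<lambda>r. norm (g r))"
    using lambert_sums[of q "\<lambda>r. of_nat r ^ N" N 1] lambert_summable_norm[of q "\<lambda>r. of_nat r ^ N" N 1] q N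
    by (simp_all add: g_def[abs_def])
  then have "(g has_sum lambert (\<lambda>r. of_nat r ^ N) q 1) UNIV"
    by (intro norm_summable_imp_has_sum)
  then have g_sum: "(g has_sum lambert (\<lambda>r. of_nat r ^ N) q 1) {1..}"
    by (rule has_sum_cong_neutral[THEN iffD1, rotated -1]) (use g0 in \<open>auto simp: not_less_eq_eq\<close>)
  have geo: "((\<lambda>d. f (r, d)) has_sum g r) {1..}" if "r \<ge> 1" for r
    using geometric_multiples_has_sum[of q r "of_nat r ^ N"] q that by (simp add: f_def g_def)
  have "(\<lambda>p. norm (f p)) summable_on ({1..} \<times> {1..})"
  proof (rule Infinite_Sum.abs_summable_on_Sigma_iff[THEN iffD2], intro conjI ballI)
    fix r :: nat assume "r \<in> {1..}"
    then have "(\<lambda>d. f (r, d)) summable_on {1..}" by (intro has_sum_imp_summable[OF geo]) simp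
    then show "(\<lambda>d. norm (f (r, d))) summable_on {1..}"
      by (rule summable_on_iff_abs_summable_on_complex[THEN iffD1])
  next
    define h where "h r = of_nat r ^ N * norm q ^ r / (1 - norm q ^ r)" for r :: nat
    have h_le: "h r \<le> inverse (1 - norm q) * (of_nat r ^ N * norm q ^ r)" for r
    proof (cases "r = 0")
      case False
      then have "norm q ^ r \<le> norm q" using power_decreasing[of 1 r "norm q"] q by simp
      then have "inverse (1 - norm q ^ r) \<le> inverse (1 - norm q)" using q by (intro le_imp_inverse_le) auto
      then have "(of_nat r ^ N * norm q ^ r) * inverse (1 - norm q ^ r) \<le> (of_nat r ^ N * norm q ^ r) * inverse (1 - norm q)"
        by (intro mult_left_mono) auto
      then show ?thesis by (simp add: h_def field_simps)
    qed (use N q in \<open>simp add: h_def\<close>)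
    have h_nonneg: "h r \<ge> 0" for r using q by (auto simp: h_def power_le_one)
    have smb: "summable (\<lambda>r. inverse (1 - norm q) * (of_nat r ^ N * norm q ^ r))"
      using q by (intro summable_mult summable_of_nat_power_mult_power) auto
    have "summable (\<lambda>r. norm (h r))"
      by (rule summable_comparison_test'[OF smb, of 0]) (use h_le h_nonneg in simp)
    then have "h summable_on UNIV" by (rule norm_summable_imp_summable_on)
    then have "h summable_on {1..}" by (rule summable_on_subset_banach) simp
    moreover have "norm (\<Sum>\<^sub>\<infinity>d\<in>{1..}. norm (f (r, d))) = h r" if "r \<in> {1..}" for r
    proof -
      have "(\<Sum>\<^sub>\<infinity>d\<in>{1..}. norm (f (r, d))) = h r"
        using geometric_multiples_has_sum[of "norm q" r "of_nat r ^ N"] q that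
        by (simp add: f_def h_def norm_mult norm_power infsumI)
      then show ?thesis using h_nonneg by simp
    qed
    then have "(\<lambda>r. norm (\<Sum>\<^sub>\<infinity>d\<in>{1..}. norm (f (r, d)))) summable_on {1..} \<longleftrightarrow> h summable_on {1..}"
      by (rule summable_on_cong)
    ultimately show "(\<lambda>r. norm (\<Sum>\<^sub>\<infinity>d\<in>{1..}. norm (f (r, d)))) summable_on {1..}" by blast
  qed
  then have "f summable_on ({1..} \<times> {1..})" by (rule abs_summable_summable)
  then have sum_rd: "(f has_sum lambert (\<lambda>r. of_nat r ^ N) q 1) ({1..} \<times> {1..})"
    using geo g_sum by (intro has_sum_SigmaI[where g = g]) simp_all
  have pos: "Suc 0 \<le> l div d \<and> Suc 0 \<le> d" if "d dvd l" "Suc 0 \<le> l" for l d :: nat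
    using that dvd_imp_le[of d l] div_greater_zero_iff[of l d] by (cases "d = 0") (auto simp: Suc_le_eq)
  \<comment> \<open>The pair (r, d) goes to (r d, r), so afterwards the second component is the
    divisor that carries the exponent N.\<close>
  have "(f has_sum lambert (\<lambda>r. of_nat r ^ N) q 1) ({1..} \<times> {1..}) \<longleftrightarrow>
      ((\<lambda>(l, d). of_nat d ^ N * q ^ l) has_sum lambert (\<lambda>r. of_nat r ^ N) q 1) (Sigma {1..} (\<lambda>l. {d. d dvd l}))"
    by (rule has_sum_reindex_bij_witness[where i = "\<lambda>(l, d). (d, l div d)" and j = "\<lambda>(r, d). (r * d, r)"])
       (use pos in \<open>auto simp: f_def\<close>)
  then have "((\<lambda>(l, d). of_nat d ^ N * q ^ l) has_sum lambert (\<lambda>r. of_nat r ^ N) q 1)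
      (Sigma {1..} (\<lambda>l. {d. d dvd l}))" using sum_rd by blast
  moreover have "((\<lambda>d. (\<lambda>(l, d). of_nat d ^ N * q ^ l) (l, d)) has_sum
      (of_nat (divisor_power_sum N l) * q ^ l)) {d. d dvd l}" if "l \<in> {1..}" for l
    using that by (intro has_sum_finiteI) (simp_all add: divisor_power_sum_def sum_distrib_right)
  ultimately show ?thesis by (rule has_sum_SigmaD)
qed

section \<open>Bernoulli numbers\<close>

text \<open>Polymorphic because the sign argument takes place over the reals, whereas the Laurent
  expansion of \<open>bose\<close> is complex.\<close>

definition bernoulli_fps :: "'a :: field_char_0 fps" where
  "bernoulli_fps = fps_X / (fps_exp 1 - 1)"

lemma subdegree_fps_exp_minus_1: "subdegree (fps_exp 1 - 1 :: 'a :: field_char_0 fps) = 1"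
  by (rule subdegreeI) auto

lemma fps_exp_minus_1_nonzero: "(fps_exp 1 - 1 :: 'a :: field_char_0 fps) \<noteq> 0"
  using subdegree_fps_exp_minus_1[where 'a = 'a] by (metis subdegree_0 zero_neq_one)

lemma bernoulli_fps_times: "bernoulli_fps * (fps_exp 1 - 1) = (fps_X :: 'a :: field_char_0 fps)"
proof -
  have "(fps_exp 1 - 1 :: 'a fps) dvd fps_X"
    using fps_dvd_iff[of "fps_exp 1 - 1" "fps_X :: 'a fps"] fps_exp_minus_1_nonzero[where 'a = 'a]
      subdegree_fps_exp_minus_1[where 'a = 'a] subdegree_fps_X[where 'a = 'a] fps_X_neq_zero[where 'a = 'a]
    by (metis order_refl)
  then show ?thesis unfolding bernoulli_fps_def by (rule dvd_div_mult_self)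
qed

lemma bernoulli_fps_of_real:
  "fps_nth (bernoulli_fps :: complex fps) n = of_real (fps_nth bernoulli_fps n)"
proof -
  define F :: "complex fps" where "F = Abs_fps (\<lambda>n. of_real (fps_nth bernoulli_fps n))"
  have "F * (fps_exp 1 - 1) = fps_X"
  proof (rule fps_ext)
    fix n
    have "fps_nth (F * (fps_exp 1 - 1)) n = of_real (fps_nth (bernoulli_fps * (fps_exp 1 - 1)) n)"
      by (simp add: fps_mult_nth F_def fps_exp_def if_distrib[of of_real] cong: if_cong)
    then show "fps_nth (F * (fps_exp 1 - 1)) n = fps_nth fps_X n"
      unfolding bernoulli_fps_times by (simp add: fps_X_def)
  qed
  then have "F * (fps_exp 1 - 1) = bernoulli_fps * (fps_exp 1 - 1)" by (simp add: bernoulli_fps_times)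
  then have "F = bernoulli_fps" using fps_exp_minus_1_nonzero[where 'a = complex] by simp
  then show ?thesis by (simp add: F_def fps_eq_iff)
qed

text \<open>With E = exp X - 1, the relations F E = X and E' = E + 1 allow E to be eliminated,
  leaving a Riccati equation. Its recurrence is quadratic in the coefficients, which makes the signs
  visible.\<close>

lemma bernoulli_fps_ode:
  "fps_X * fps_deriv bernoulli_fps =
     (bernoulli_fps - bernoulli_fps ^ 2 - fps_X * bernoulli_fps :: 'a :: field_char_0 fps)"
proof -
  define F :: "'a fps" where "F = bernoulli_fps"
  define E :: "'a fps" where "E = fps_exp 1 - 1"
  have FE: "F * E = fps_X" using bernoulli_fps_times[where 'a = 'a] by (simp add: F_def E_def)
  have E': "fps_deriv E = E + 1" by (simp add: E_def)
  have "fps_deriv (F * E) = 1" by (simp add: FE)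
  then have d: "fps_deriv F * E + F * (E + 1) = 1" by (simp add: E' add_ac mult_ac)
  have "fps_X * fps_deriv F = F * (fps_deriv F * E)" by (simp add: FE[symmetric] mult_ac)
  also have "fps_deriv F * E = 1 - F * E - F" using d by (simp add: algebra_simps)
  finally have "fps_X * fps_deriv F = F * (1 - fps_X - F)" by (simp only: FE)
  then show ?thesis by (simp add: F_def[symmetric] power2_eq_square algebra_simps)
qed

lemma fps_nth_square_split:
  fixes F :: "'a :: comm_ring_1 fps"
  assumes "n \<ge> 3"
  shows "fps_nth (F ^ 2) n = 2 * fps_nth F 0 * fps_nth F n + 2 * fps_nth F 1 * fps_nth F (n - 1) +
           (\<Sum>i=2..n-2. fps_nth F i * fps_nth F (n - i))"
proof -
  have "{0..n} = {0, 1, n - 1, n} \<union> {2..n-2}" using assms by auto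
  moreover have "{0, 1, n - 1, n} \<inter> {2..n-2} = {}" using assms by auto
  ultimately have "fps_nth (F ^ 2) n = (\<Sum>i\<in>{0, 1, n - 1, n}. fps_nth F i * fps_nth F (n - i)) +
      (\<Sum>i=2..n-2. fps_nth F i * fps_nth F (n - i))"
    unfolding power2_eq_square fps_mult_nth by (subst sum.union_disjoint[symmetric]) auto
  then show ?thesis using assms by (simp add: algebra_simps)
qed

lemma bernoulli_fps_nth_0: "fps_nth bernoulli_fps 0 = (1 :: 'a :: field_char_0)"
  using arg_cong[OF bernoulli_fps_times[where 'a = 'a], of "\<lambda>F. fps_nth F 1"]
  by (simp add: fps_mult_nth)

lemma bernoulli_fps_nth_1: "fps_nth bernoulli_fps (Suc 0) = (- 1 / 2 :: 'a :: field_char_0)"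
  using arg_cong[OF bernoulli_fps_times[where 'a = 'a], of "\<lambda>F. fps_nth F 2"]
  by (simp add: fps_mult_nth numeral_2_eq_2 bernoulli_fps_nth_0 eq_neg_iff_add_eq_0 add_ac fps_X_def)

text \<open>Because the coefficient of index 1 is -1/2, the terms of index n - 1 coming from F^2 and
  X F cancel; the terms of index n combine to the factor n + 1.\<close>

lemma bernoulli_fps_recurrence:
  assumes "n \<ge> 3"
  shows "of_nat (n + 1) * fps_nth bernoulli_fps n =
      - (\<Sum>i=2..n-2. fps_nth bernoulli_fps i * fps_nth bernoulli_fps (n - i) :: 'a :: field_char_0)"
  using arg_cong[OF bernoulli_fps_ode[where 'a = 'a], of "\<lambda>F. fps_nth F n"] assms
  by (simp add: fps_nth_square_split bernoulli_fps_nth_0 bernoulli_fps_nth_1 ring_distribs eq_neg_iff_add_eq_0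
      algebra_simps)

lemma bernoulli_fps_nth_2: "fps_nth bernoulli_fps 2 = (1 / 12 :: 'a :: field_char_0)"
  using arg_cong[OF bernoulli_fps_ode[where 'a = 'a], of "\<lambda>F. fps_nth F 2"]
  by (simp add: power2_eq_square fps_mult_nth numeral_2_eq_2 bernoulli_fps_nth_0 bernoulli_fps_nth_1 field_simps)

text \<open>For even n the sign of a product of two factors of even index i and n - i depends only
  on n, so the recurrence has no cancellation; for odd n one factor of each product has odd index at
  least 2 and vanishes. The aim is that B_{2j}, by which \<open>eisenstein_E\<close> divides, is
  nonzero.\<close>

lemma bernoulli_fps_sign:
  assumes "n \<ge> 2"
  shows "(odd n \<longrightarrow> fps_nth bernoulli_fps n = (0 :: real)) \<and>
         (even n \<longrightarrow> (-1) ^ (n div 2 + 1) * fps_nth bernoulli_fps n > (0 :: real))"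
  using assms
proof (induction n rule: less_induct)
  case (less n)
  define f where "f = fps_nth (bernoulli_fps :: real fps)"
  show ?case
  proof (cases "n = 2")
    case True
    then show ?thesis by (simp add: bernoulli_fps_nth_2)
  next
    case False
    then have n: "n \<ge> 3" using less.prems by simp
    have rec: "of_nat (n + 1) * f n = - (\<Sum>i=2..n-2. f i * f (n - i))"
      unfolding f_def by (rule bernoulli_fps_recurrence[OF n])
    have odd0: "f i = 0" if "odd i" "2 \<le> i" "i < n" for i
      using less.IH[of i] that by (simp add: f_def)
    show ?thesis
    proof (cases "even n")
      case False
      have "f i * f (n - i) = 0" if "i \<in> {2..n-2}" for i
      proof (cases "even i")
        case True
        then have "odd (n - i)" using that False n by auto
        moreover have "2 \<le> n - i" "n - i < n" using that n by auto
        ultimately show ?thesis using odd0[of "n - i"] by simp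
      qed (use that odd0[of i] n in auto)
      then have "(\<Sum>i=2..n-2. f i * f (n - i)) = 0" by (intro sum.neutral) blast
      then have "of_nat (n + 1) * f n = 0" using rec by (simp only: minus_zero)
      then have "f n = 0" by (simp del: of_nat_add of_nat_Suc)
      then show ?thesis using False by (simp add: f_def)
    next
      case True
      define s where "s = (- 1 :: real) ^ (n div 2)"
      have nonneg: "s * (f i * f (n - i)) > 0" if "even i" "i \<in> {2..n-2}" for i
      proof -
        have "n div 2 = i div 2 + (n - i) div 2" using that True by (auto elim!: evenE)
        then have "s = (-1) ^ (i div 2 + 1) * (-1) ^ ((n - i) div 2 + 1)"
          unfolding s_def by (simp flip: power_add)
        then have "s * (f i * f (n - i)) = ((-1) ^ (i div 2 + 1) * f i) * ((-1) ^ ((n - i) div 2 + 1) * f (n - i))"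
          by (simp add: mult_ac)
        moreover have "(-1) ^ (i div 2 + 1) * f i > 0"
          using less.IH[of i] that n unfolding f_def by auto
        moreover have "(-1) ^ ((n - i) div 2 + 1) * f (n - i) > 0"
          using less.IH[of "n - i"] that n True unfolding f_def by auto
        ultimately show ?thesis by (metis mult_pos_pos)
      qed
      have "s * (f i * f (n - i)) \<ge> 0" if "i \<in> {2..n-2}" for i
        using nonneg[of i] odd0[of i] that by (cases "even i") (auto intro: less_imp_le)
      \<comment> \<open>This puts the index 2 into the range of summation, which supplies a strictly
        positive term.\<close>
      moreover have "n \<ge> 4" using n True by (cases "n = 3") auto
      ultimately have "(\<Sum>i=2..n-2. s * (f i * f (n - i))) > 0"
        using nonneg[of 2] by (intro sum_pos2[of _ 2]) auto
      then have "of_nat (n + 1) * (- s * f n) > 0"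
        using rec by (simp add: sum_distrib_left algebra_simps)
      then have "- s * f n > 0" by (rule zero_less_mult_pos) simp
      then show ?thesis using True by (simp add: f_def s_def)
    qed
  qed
qed

lemma bernoulli_number_altdef: "bernoulli_number k = fact k * fps_nth bernoulli_fps k"
  by (simp add: bernoulli_number_def bernoulli_fps_def)

lemma bernoulli_number_even_nonzero:
  assumes "even k" "k > 0"
  shows "bernoulli_number k \<noteq> 0"
proof -
  have "k \<ge> 2" using assms by auto
  then show ?thesis using bernoulli_fps_sign[of k] assms unfolding bernoulli_number_altdef by auto
qed

lemma bose_has_laurent_expansion:
  "bose has_laurent_expansion - (fps_to_fls bernoulli_fps * fls_X_inv)"
proof -
  define E :: "complex fls" where "E = fps_to_fls (fps_exp 1 - 1)"
  have E0: "E \<noteq> 0" using fps_exp_minus_1_nonzero[where 'a = complex] by (simp add: E_def)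
  have "(\<lambda>s. - 1 / (exp s - 1)) has_laurent_expansion (- 1 / E)"
    unfolding E_def by (intro laurent_expansion_intros has_laurent_expansion_fps fps_expansion_intros)
  moreover have "bose = (\<lambda>s. - 1 / (exp s - 1))"
    by (auto simp: bose_def fun_eq_iff) (metis minus_diff_eq minus_divide_right)
  moreover have "- 1 / E = - (fps_to_fls bernoulli_fps * fls_X_inv)"
  proof -
    have "fps_to_fls bernoulli_fps * E = fls_X"
      unfolding E_def fls_times_fps_to_fls[symmetric] bernoulli_fps_times by simp
    moreover have "fps_to_fls bernoulli_fps * fls_X_inv * E = fps_to_fls bernoulli_fps * E * fls_X_inv"
      by (simp only: mult_ac)
    ultimately have "fps_to_fls bernoulli_fps * fls_X_inv * E = 1"
      by (simp add: fls_X_inv_times_conv_shift(2))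
    then show ?thesis using E0 by (simp add: field_simps)
  qed
  ultimately show ?thesis by simp
qed

lemma fls_nth_higher_deriv:
  "fls_nth ((fls_deriv ^^ N) (F :: 'a :: field_char_0 fls)) n = pochhammer (of_int (n + 1)) N * fls_nth F (n + int N)"
proof (induction N arbitrary: n)
  case (Suc N)
  then show ?case
    by (simp add: pochhammer_rec add_ac)
qed auto

lemma has_laurent_expansion_higher_deriv:
  "f has_laurent_expansion F \<Longrightarrow> (deriv ^^ N) f has_laurent_expansion (fls_deriv ^^ N) F"
  by (induction N) (auto intro: has_laurent_expansion_deriv)

text \<open>For odd N the leading term - 1/s differentiates to N! / s^(N+1), and no other negative
  power occurs. The limit is N! times the coefficient of s^N in \<open>bose\<close>, that is N! (-
  B_{N+1} / (N+1)!).\<close>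

lemma higher_deriv_bose_limit:
  assumes "odd N"
  shows "((\<lambda>s. (deriv ^^ N) bose s - fact N / s ^ Suc N) \<longlongrightarrow>
      - of_real (bernoulli_number (Suc N)) / of_nat (Suc N)) (at 0)"
proof -
  define F :: "complex fls" where "F = - (fps_to_fls bernoulli_fps * fls_X_inv)"
  have F_nth: "fls_nth F n = (if n < -1 then 0 else - of_real (fps_nth bernoulli_fps (nat (n + 1))))" for n
    by (simp add: F_def bernoulli_fps_of_real fls_X_inv_times_conv_shift)
  define G where "G = (fls_deriv ^^ N) F - fls_const (fact N) * fls_X_inv ^ Suc N"
  have G: "(\<lambda>s. (deriv ^^ N) bose s - fact N / s ^ Suc N) has_laurent_expansion G"
  proof -
    have inv: "(\<lambda>s. inverse s ^ Suc N) has_laurent_expansion (fls_X_inv ^ Suc N :: complex fls)"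
      by (intro has_laurent_expansion_power has_laurent_expansion_fls_X_inv)
    have "(\<lambda>s. (deriv ^^ N) bose s - fact N * inverse s ^ Suc N) has_laurent_expansion G"
      unfolding G_def F_def
      by (rule has_laurent_expansion_diff[OF has_laurent_expansion_higher_deriv[OF bose_has_laurent_expansion]
            has_laurent_expansion_cmult_left[OF inv]])
    then show ?thesis by (simp only: divide_inverse power_inverse)
  qed
  have poch: "pochhammer (- of_nat N :: complex) N = - fact N"
    using pochhammer_same[of N, where 'a = complex] assms by (simp add: pochhammer_minus)
  have Xinv: "fls_nth (fls_X_inv ^ Suc N :: complex fls) n = (if n = - int (Suc N) then 1 else 0)" for n
    unfolding fls_X_inv_power_conv_shift_1 by simp
  have "fls_nth G n = 0" if "n < 0" for n
  proof -
    consider "n < - int (Suc N)" | "n = - int (Suc N)" | "n > - int (Suc N)" by linarith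
    then show ?thesis
    proof cases
      case 1
      then show ?thesis by (simp add: G_def fls_nth_higher_deriv F_nth Xinv del: power_Suc)
    next
      case 2
      then show ?thesis using poch
        by (simp add: G_def fls_nth_higher_deriv F_nth Xinv bernoulli_fps_nth_0 del: power_Suc)
    next
      case 3
      \<comment> \<open>For - N <= n < 0 the product (n + 1) ... (n + N) contains the factor 0, so
        differentiating N times leaves no pole terms in this range.\<close>
      define k where "k = nat (- (n + 1))"
      have k: "n + 1 = - int k" using that by (simp add: k_def)
      then have "pochhammer (- of_nat k :: complex) N = 0"
        using 3 by (intro pochhammer_of_nat_eq_0_lemma) simp
      then have "pochhammer (of_int (n + 1) :: complex) N = 0" unfolding k by simp
      then show ?thesis using 3 by (simp add: G_def fls_nth_higher_deriv Xinv del: power_Suc)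
    qed
  qed
  then have "fls_subdegree G \<ge> 0" by (rule fls_subdegree_ge0I)
  then have "(\<lambda>s. (deriv ^^ N) bose s - fact N / s ^ Suc N) \<midarrow>0\<rightarrow> fls_nth G 0"
    using has_laurent_expansion_imp_tendsto_0[OF G] by auto
  moreover have "fls_nth G 0 = - of_real (bernoulli_number (Suc N)) / of_nat (Suc N)"
  proof -
    have "fls_nth G 0 = - (fact N * of_real (fps_nth bernoulli_fps (Suc N)))"
      by (simp add: G_def fls_nth_higher_deriv F_nth Xinv pochhammer_fact[symmetric] nat_add_distrib del: power_Suc)
    then show ?thesis by (simp add: bernoulli_number_altdef del: of_nat_Suc)
  qed
  ultimately show ?thesis by simp
qed

section \<open>The zeros of the theta function\<close>

text \<open>From here on \<open>nome\<close> serves both variables: \<open>nome \<tau>\<close> is q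
  and \<open>nome z\<close> is zeta.\<close>

lemma nome_add: "nome (z + w) = nome z * nome w"
  by (simp add: nome_def ring_distribs exp_add)

lemma nome_nonzero [simp]: "nome z \<noteq> 0"
  by (simp add: nome_def)

lemma nome_minus: "nome (- z) = inverse (nome z)"
  by (simp add: nome_def exp_minus)

lemma nome_of_int [simp]: "nome (of_int n) = 1"
  using exp_integer_2pi[of "of_int n"] by (simp add: nome_def mult_ac)

lemma nome_1 [simp]: "nome 1 = 1"
  using nome_of_int[of 1] by simp

lemma nome_0 [simp]: "nome 0 = 1"
  by (simp add: nome_def)

lemma norm_nome: "norm (nome z) = exp (- (2 * pi * Im z))"
  by (simp add: nome_def)

lemma norm_nome_less_1_iff: "norm (nome z) < 1 \<longleftrightarrow> Im z > 0"
  by (simp add: norm_nome zero_less_mult_iff)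

lemma norm_nome_mult_nome_less_1_iff: "norm (nome \<tau> * nome z) < 1 \<longleftrightarrow> Im z > - Im \<tau>"
  unfolding nome_add[symmetric] norm_nome_less_1_iff by auto

lemma nome_eq_1_iff: "nome z = 1 \<longleftrightarrow> z \<in> \<int>"
proof
  assume "nome z = 1"
  then obtain n :: int where "Im (2 * of_real pi * \<i> * z) = of_int (2 * n) * pi" "Re (2 * of_real pi * \<i> * z) = 0"
    unfolding nome_def exp_eq_1 by blast
  then have "z = of_int n" by (simp add: complex_eq_iff)
  then show "z \<in> \<int>" by simp
qed (auto elim!: Ints_cases)

lemma nome_holomorphic [holomorphic_intros]:
  "f holomorphic_on A \<Longrightarrow> (\<lambda>z. nome (f z)) holomorphic_on A"
  unfolding nome_def by (intro holomorphic_intros)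

lemma sin_pi_eq_0_iff: "sin (of_real pi * z) = 0 \<longleftrightarrow> z \<in> \<int>" for z :: complex
  by (auto simp: sin_eq_0 elim!: Ints_cases)

lemma sin_pi_altdef: "sin (of_real pi * z) = - exp (- (\<i> * of_real pi * z)) * (1 - nome z) / (2 * \<i>)"
  and sin_pi_altdef': "sin (of_real pi * z) = exp (\<i> * of_real pi * z) * (1 - nome (- z)) / (2 * \<i>)"
proof -
  have "exp (- (\<i> * of_real pi * z)) * nome z = exp (\<i> * of_real pi * z)"
    unfolding nome_def exp_add[symmetric] by (rule arg_cong[where f = exp]) simp
  then show "sin (of_real pi * z) = - exp (- (\<i> * of_real pi * z)) * (1 - nome z) / (2 * \<i>)"
    by (simp add: sin_exp_eq algebra_simps)
  have "exp (\<i> * of_real pi * z) * nome (- z) = exp (- (\<i> * of_real pi * z))"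
    unfolding nome_def exp_add[symmetric] by (rule arg_cong[where f = exp]) simp
  then show "sin (of_real pi * z) = exp (\<i> * of_real pi * z) * (1 - nome (- z)) / (2 * \<i>)"
    by (simp add: sin_exp_eq algebra_simps)
qed

lemma jacobi_theta_of_int: "jacobi_theta (of_int n) \<tau> = 0"
  using periodic_int_shift[of UNIV "\<lambda>z. jacobi_theta z \<tau> = 0" 0 n]
  by (simp add: jacobi_theta_plus_1 jacobi_theta_0)

text \<open>Up to the factor exp (pi i z), theta on the real line is a Fourier series with nonzero
  coefficients. A real z is wanted because it lies in the strip where theta is compared with
  \<open>theta_product\<close>.\<close>

lemma jacobi_theta_not_identically_0:
  assumes "Im \<tau> > 0"
  shows "\<exists>z. Im z = 0 \<and> jacobi_theta z \<tau> \<noteq> 0"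
proof (rule ccontr)
  assume "\<not> ?thesis"
  then have zero: "jacobi_theta z \<tau> = 0" if "Im z = 0" for z using that by blast
  define a where "a k = exp (of_real pi * \<i> * (of_int k + 1/2)\<^sup>2 * \<tau> + of_real pi * \<i> * (of_int k + 1/2))" for k :: int
  have "((\<lambda>k. a k * exp (2 * of_real pi * \<i> * z) powi k) has_sum 0) UNIV" if "Im z = 0" for z
  proof -
    have "theta_term 0 k z \<tau> = exp (of_real pi * \<i> * z) * (a k * exp (2 * of_real pi * \<i> * z) powi k)" for k
      unfolding theta_term_def a_def exp_power_int power_0 mult_1 exp_add[symmetric]
      by (rule arg_cong[where f = exp]) (simp add: field_simps)
    then have "((\<lambda>k. exp (of_real pi * \<i> * z) * (a k * exp (2 * of_real pi * \<i> * z) powi k)) has_sum 0) UNIV"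
      using theta_term_has_sum[OF assms, of 0 z] zero[OF that] by (simp add: theta_deriv_0)
    then show ?thesis by (subst (asm) has_sum_cmult_right_iff) auto
  qed
  then have "a 0 = 0" by (rule fourier_coefficients_zero)
  then show False by (simp add: a_def)
qed

text \<open>The exponential is the product of (1 - q^n zeta) (1 - q^n / zeta) over n >= 1, known
  from Jacobi's triple product, written through its logarithm; in this form the zeros in the strip
  are visibly those of the sine. The coefficient \<open>1 / of_nat 0\<close> is 0, as the lemmas on
  \<open>lambert\<close> demand.\<close>

definition theta_product :: "complex \<Rightarrow> complex \<Rightarrow> complex" where
  "theta_product \<tau> z = sin (of_real pi * z) *
     exp (- lambert (\<lambda>r. 1 / of_nat r) (nome \<tau>) (nome z) - lambert (\<lambda>r. 1 / of_nat r) (nome \<tau>) (nome (- z)))"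

context
  fixes \<tau> :: complex
  assumes \<tau>: "Im \<tau> > 0"
begin

lemma log_coeff_bound: "norm (1 / of_nat r :: complex) \<le> of_nat r ^ 0"
  by (cases "r = 0") (auto simp: norm_divide)

lemma log_sums: "norm x < 1 \<Longrightarrow> (\<lambda>r. 1 / of_nat r * x ^ r) sums (- Ln (1 - x))" for x :: complex
  using sums_minus[OF Ln_series'[of "- x"]] by simp

lemma log_lambert_diff:
  assumes "norm (nome \<tau> * w) < 1"
  shows "lambert (\<lambda>r. 1 / of_nat r) (nome \<tau>) (nome \<tau> * w) = lambert (\<lambda>r. 1 / of_nat r) (nome \<tau>) w + Ln (1 - nome \<tau> * w)"
proof -
  have "norm (nome \<tau>) < 1" using \<tau> by (simp add: norm_nome_less_1_iff)
  then have "- Ln (1 - nome \<tau> * w) =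
      lambert (\<lambda>r. 1 / of_nat r) (nome \<tau>) w - lambert (\<lambda>r. 1 / of_nat r) (nome \<tau>) (nome \<tau> * w)"
    by (intro sums_unique2[OF log_sums[OF assms]] lambert_functional_equation[OF _ _ log_coeff_bound assms]) auto
  then show ?thesis by (simp add: algebra_simps)
qed

lemma lambert_nome_holomorphic:
  assumes "b 0 = 0" "\<And>r. norm (b r) \<le> of_nat r ^ N"
  shows "(\<lambda>z. lambert b (nome \<tau>) (nome z)) holomorphic_on {z. Im z > - Im \<tau>}"
    and "(\<lambda>z. lambert b (nome \<tau>) (nome (- z))) holomorphic_on {z. Im z < Im \<tau>}"
proof -
  have "norm (nome \<tau>) < 1" using \<tau> by (simp add: norm_nome_less_1_iff)
  note hol = lambert_holomorphic[OF this assms]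
  show "(\<lambda>z. lambert b (nome \<tau>) (nome z)) holomorphic_on {z. Im z > - Im \<tau>}"
    by (rule holomorphic_on_compose_gen[OF _ hol, unfolded o_def])
       (auto intro!: holomorphic_intros simp: norm_nome_mult_nome_less_1_iff)
  show "(\<lambda>z. lambert b (nome \<tau>) (nome (- z))) holomorphic_on {z. Im z < Im \<tau>}"
    by (rule holomorphic_on_compose_gen[OF _ hol, unfolded o_def])
       (auto intro!: holomorphic_intros simp: norm_nome_mult_nome_less_1_iff)
qed

lemma theta_product_holomorphic: "theta_product \<tau> holomorphic_on {z. \<bar>Im z\<bar> < Im \<tau>}"
  unfolding theta_product_def
  by (intro holomorphic_intros holomorphic_on_subset[OF lambert_nome_holomorphic(1)[OF _ log_coeff_bound]]
      holomorphic_on_subset[OF lambert_nome_holomorphic(2)[OF _ log_coeff_bound]]) auto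

lemma theta_product_eq_0_iff: "theta_product \<tau> z = 0 \<longleftrightarrow> z \<in> \<int>"
  by (simp add: theta_product_def sin_pi_eq_0_iff)

lemma theta_product_plus_1: "theta_product \<tau> (z + 1) = - theta_product \<tau> z"
proof -
  have "nome (- (z + 1)) = nome (- z)" "nome (z + 1) = nome z"
    unfolding nome_minus nome_add by simp_all
  moreover have "sin (of_real pi * (z + 1)) = - sin (of_real pi * z)"
    by (simp add: ring_distribs sin_add flip: sin_of_real cos_of_real)
  ultimately show ?thesis by (simp add: theta_product_def)
qed

text \<open>The shift changes the two Lambert series by logarithms of 1 - nome (z + tau) and 1 -
  nome (- z). These trade the first factor, contained in the sine at z + tau, for the second,
  contained in the sine at z, and leave only exponentials.\<close>

lemma theta_product_plus_tau:
  assumes "- Im \<tau> < Im z" "Im z < 0"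
  shows "theta_product \<tau> (z + \<tau>) = - exp (- (of_real pi * \<i> * \<tau>) - 2 * of_real pi * \<i> * z) * theta_product \<tau> z"
proof -
  define lam where "lam = lambert (\<lambda>r. 1 / of_nat r) (nome \<tau>)"
  have 1: "lam (nome (z + \<tau>)) = lam (nome z) + Ln (1 - nome (z + \<tau>))"
    using log_lambert_diff[of "nome z"] assms
    by (simp add: lam_def nome_add norm_nome_mult_nome_less_1_iff mult.commute)
  have "nome \<tau> * nome (- (z + \<tau>)) = nome (- z)"
    by (simp add: nome_add[symmetric])
  then have 2: "lam (nome (- (z + \<tau>))) = lam (nome (- z)) - Ln (1 - nome (- z))"
    using log_lambert_diff[of "nome (- (z + \<tau>))"] assms
    by (simp add: lam_def norm_nome_less_1_iff)
  have nz: "1 - nome (z + \<tau>) \<noteq> 0" "1 - nome (- z) \<noteq> 0"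
    using norm_nome_less_1_iff[of "z + \<tau>"] norm_nome_less_1_iff[of "- z"] assms by auto
  have "theta_product \<tau> (z + \<tau>) = sin (of_real pi * (z + \<tau>)) *
      exp (- lam (nome z) - lam (nome (- z)) + (Ln (1 - nome (- z)) - Ln (1 - nome (z + \<tau>))))"
    unfolding theta_product_def lam_def[symmetric] 1 2 by (simp add: algebra_simps)
  also have "\<dots> = exp (- lam (nome z) - lam (nome (- z))) *
      (sin (of_real pi * (z + \<tau>)) * (1 - nome (- z)) / (1 - nome (z + \<tau>)))"
    using nz by (simp add: exp_add exp_diff)
  also have "sin (of_real pi * (z + \<tau>)) * (1 - nome (- z)) / (1 - nome (z + \<tau>)) =
      - exp (- (\<i> * of_real pi * (z + \<tau>))) * ((1 - nome (- z)) / (2 * \<i>))"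
  proof -
    have "- x * u / (2 * \<i>) * v / u = - x * (v / (2 * \<i>))" if "u \<noteq> 0" for x u v :: complex
      using that by simp
    then show ?thesis unfolding sin_pi_altdef[of "z + \<tau>"] using nz(1) by blast
  qed
  also have "(1 - nome (- z)) / (2 * \<i>) = exp (- (\<i> * of_real pi * z)) * sin (of_real pi * z)"
    unfolding sin_pi_altdef'[of z] by (simp add: exp_minus)
  also have "- exp (- (\<i> * of_real pi * (z + \<tau>))) * (exp (- (\<i> * of_real pi * z)) * sin (of_real pi * z)) =
      - (exp (- (\<i> * of_real pi * (z + \<tau>))) * exp (- (\<i> * of_real pi * z))) * sin (of_real pi * z)" by simp
  also have "exp (- (\<i> * of_real pi * (z + \<tau>))) * exp (- (\<i> * of_real pi * z)) =
      exp (- (of_real pi * \<i> * \<tau>) - 2 * of_real pi * \<i> * z)"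
    unfolding exp_add[symmetric] by (rule arg_cong[where f = exp]) (simp add: algebra_simps)
  finally show ?thesis by (simp add: theta_product_def lam_def)
qed

lemma theta_product_div_self_limit:
  obtains d where "((\<lambda>z. theta_product \<tau> z / z) \<longlongrightarrow> d) (at 0)" "d \<noteq> 0"
proof -
  define g where "g z = exp (- lambert (\<lambda>r. 1 / of_nat r) (nome \<tau>) (nome z) - lambert (\<lambda>r. 1 / of_nat r) (nome \<tau>) (nome (- z)))" for z
  have "g holomorphic_on {z. \<bar>Im z\<bar> < Im \<tau>}"
    unfolding g_def
    by (intro holomorphic_intros holomorphic_on_subset[OF lambert_nome_holomorphic(1)[OF _ log_coeff_bound]]
      holomorphic_on_subset[OF lambert_nome_holomorphic(2)[OF _ log_coeff_bound]]) auto
  then have "isCont g 0"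
    using continuous_on_eq_continuous_at[OF open_strip[of "Im \<tau>"], of g] holomorphic_on_imp_continuous_on \<tau>
    by auto
  then have "(g \<longlongrightarrow> g 0) (at 0)" by (simp add: isCont_def)
  moreover have "((\<lambda>z. sin (of_real pi * z)) has_field_derivative of_real pi) (at (0 :: complex))"
    by (auto intro!: derivative_eq_intros)
  then have "((\<lambda>z. sin (of_real pi * z) / z) \<longlongrightarrow> of_real pi) (at (0 :: complex))"
    by (simp add: DERIV_def)
  ultimately have "((\<lambda>z. sin (of_real pi * z) / z * g z) \<longlongrightarrow> of_real pi * g 0) (at 0)"
    by (intro tendsto_mult)
  then show ?thesis
    by (intro that[of "of_real pi * g 0"]) (simp_all add: theta_product_def g_def)
qed

lemma jacobi_theta_eq_theta_product:
  obtains c where "c \<noteq> 0" "\<And>z. \<bar>Im z\<bar> < Im \<tau> \<Longrightarrow> jacobi_theta z \<tau> = c * theta_product \<tau> z"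
proof -
  define f where "f z = jacobi_theta z \<tau> / theta_product \<tau> z" for z
  obtain d where d: "((\<lambda>z. theta_product \<tau> z / z) \<longlongrightarrow> d) (at 0)" "d \<noteq> 0"
    by (rule theta_product_div_self_limit)
  have hol: "f holomorphic_on ({z. \<bar>Im z\<bar> < Im \<tau>} - \<int>)"
    unfolding f_def
    by (intro holomorphic_intros jacobi_theta_holomorphic \<tau> holomorphic_on_subset[OF theta_product_holomorphic])
       (auto simp: theta_product_eq_0_iff)
  have lim: "((\<lambda>z. z * f z) \<longlongrightarrow> 0) (at 0)"
  proof -
    have "isCont (\<lambda>z. jacobi_theta z \<tau>) 0"
      using theta_deriv_has_field_derivative[OF \<tau>, of 0 0] unfolding theta_deriv_0 by (rule DERIV_isCont)
    then have "((\<lambda>z. jacobi_theta z \<tau>) \<longlongrightarrow> 0) (at 0)" by (simp add: isCont_def jacobi_theta_0)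
    from tendsto_divide[OF this d] show ?thesis by (simp add: f_def mult.commute)
  qed
  obtain c where c: "\<And>z. z \<in> {z. \<bar>Im z\<bar> < Im \<tau>} - \<int> \<Longrightarrow> f z = c"
  proof (rule quasi_elliptic_on_strip_constant[OF \<tau> hol _ _ lim])
    show "f (z + 1) = f z" for z
      by (simp add: f_def jacobi_theta_plus_1 theta_product_plus_1)
    show "norm (f (z + \<tau>)) = norm (f z)" if "- Im \<tau> < Im z" "Im z < 0" for z
      using that by (simp add: f_def jacobi_theta_plus_tau theta_product_plus_tau)
  qed blast
  have eq: "jacobi_theta z \<tau> = c * theta_product \<tau> z" if "\<bar>Im z\<bar> < Im \<tau>" for z
  proof (cases "z \<in> \<int>")
    case True
    then show ?thesis
      by (auto elim!: Ints_cases simp: jacobi_theta_of_int theta_product_eq_0_iff)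
  next
    case False
    then show ?thesis using c[of z] that by (simp add: f_def theta_product_eq_0_iff divide_eq_eq)
  qed
  moreover have "c \<noteq> 0"
    using jacobi_theta_not_identically_0[OF \<tau>] eq \<tau> by force
  ultimately show ?thesis using that by blast
qed

lemma jacobi_theta_eq_0_iff: "jacobi_theta z \<tau> = 0 \<longleftrightarrow> (\<exists>a b. z = of_int a + of_int b * \<tau>)"
proof -
  have \<tau>0: "\<tau> \<noteq> 0" using \<tau> by auto
  \<comment> \<open>Theta itself is not periodic in this direction, but its vanishing is; measuring
    in multiples of tau makes the period 1.\<close>
  have shift: "jacobi_theta (w + of_int n * \<tau>) \<tau> = 0 \<longleftrightarrow> jacobi_theta w \<tau> = 0" for w n
    using periodic_int_shift[of UNIV "\<lambda>x. jacobi_theta (x * \<tau>) \<tau> = 0" "w / \<tau>" n] \<tau>0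
    by (simp add: ring_distribs jacobi_theta_plus_tau)
  obtain c where c: "c \<noteq> 0" "\<And>z. \<bar>Im z\<bar> < Im \<tau> \<Longrightarrow> jacobi_theta z \<tau> = c * theta_product \<tau> z"
    using jacobi_theta_eq_theta_product by blast
  show ?thesis
  proof
    assume *: "jacobi_theta z \<tau> = 0"
    define n where "n = \<lfloor>Im z / Im \<tau>\<rfloor>"
    have "of_int n \<le> Im z / Im \<tau>" "Im z / Im \<tau> < of_int n + 1" by (simp_all add: n_def)
    then have "of_int n * Im \<tau> \<le> Im z" "Im z < (of_int n + 1) * Im \<tau>"
      using \<tau> by (simp_all add: field_simps)
    then have "\<bar>Im (z - of_int n * \<tau>)\<bar> < Im \<tau>" by (simp add: algebra_simps)
    moreover have "jacobi_theta (z - of_int n * \<tau>) \<tau> = 0" using shift[of "z - of_int n * \<tau>" n] * by simp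
    ultimately have "z - of_int n * \<tau> \<in> \<int>" using c theta_product_eq_0_iff by simp
    then obtain a where "z - of_int n * \<tau> = of_int a" by (auto elim: Ints_cases)
    then have "z = of_int a + of_int n * \<tau>" by (simp add: algebra_simps)
    then show "\<exists>a b. z = of_int a + of_int b * \<tau>" by blast
  next
    assume "\<exists>a b. z = of_int a + of_int b * \<tau>"
    then show "jacobi_theta z \<tau> = 0" using shift jacobi_theta_of_int by auto
  qed
qed

text \<open>The zero at 0 is simple, as for the sine. Hence the power series of theta(z) / z is
  invertible and the quotient has at most a simple pole.\<close>

lemma theta_deriv_1_nonzero: "theta_deriv 1 0 \<tau> \<noteq> 0"
proof -
  obtain c where c: "c \<noteq> 0" "\<And>z. \<bar>Im z\<bar> < Im \<tau> \<Longrightarrow> jacobi_theta z \<tau> = c * theta_product \<tau> z"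
    using jacobi_theta_eq_theta_product by blast
  obtain d where d: "((\<lambda>z. theta_product \<tau> z / z) \<longlongrightarrow> d) (at 0)" "d \<noteq> 0"
    by (rule theta_product_div_self_limit)
  have "eventually (\<lambda>z. z \<in> {z. \<bar>Im z\<bar> < Im \<tau>}) (at 0)"
    using \<tau> by (intro eventually_at_in_open' open_strip) auto
  then have "eventually (\<lambda>z. c * (theta_product \<tau> z / z) = jacobi_theta z \<tau> / z) (at 0)"
    by eventually_elim (simp add: c)
  moreover have "((\<lambda>z. c * (theta_product \<tau> z / z)) \<longlongrightarrow> c * d) (at 0)"
    by (intro tendsto_mult d tendsto_const)
  ultimately have "((\<lambda>z. jacobi_theta z \<tau> / z) \<longlongrightarrow> c * d) (at 0)"
    by (rule Lim_transform_eventually[rotated])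
  moreover have "((\<lambda>z. jacobi_theta z \<tau> / z) \<longlongrightarrow> theta_deriv 1 0 \<tau>) (at 0)"
    using theta_deriv_has_field_derivative[OF \<tau>, of 0 0]
    by (simp add: DERIV_def theta_deriv_0 jacobi_theta_0)
  ultimately have "c * d = theta_deriv 1 0 \<tau>" by (rule tendsto_unique[OF at_neq_bot])
  then show ?thesis using c(1) d(2) by auto
qed

end

section \<open>Elliptic functions with a single pole\<close>

text \<open>The continuation of the sum of r^N zeta^r / (1 - q^r) from 0 < Im z < Im tau to |Im z| <
  Im tau. For r > 0 the coefficient splits as r^N + r^N q^r / (1 - q^r), and the first parts sum to
  the derivative of \<open>bose\<close>; for r = -s < 0 and N odd it is s^N q^s / (1 - q^s).\<close>

definition elliptic_series :: "nat \<Rightarrow> complex \<Rightarrow> complex \<Rightarrow> complex" where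
  "elliptic_series N \<tau> z = (deriv ^^ N) bose (2 * of_real pi * \<i> * z) +
     lambert (\<lambda>r. of_nat r ^ N) (nome \<tau>) (nome z) + lambert (\<lambda>r. of_nat r ^ N) (nome \<tau>) (nome (- z))"

lemma higher_deriv_bose_plus_2pi: "(deriv ^^ N) bose (s + 2 * of_real pi * \<i>) = (deriv ^^ N) bose s"
proof -
  have "bose (s + 2 * of_real pi * \<i> + w) = bose (s + w)" for w
    by (simp add: bose_def exp_add)
  then have "bose \<circ> (\<lambda>w. s + 2 * of_real pi * \<i> + w) = bose \<circ> (\<lambda>w. s + w)"
    by (simp add: fun_eq_iff)
  then show ?thesis by (simp only: higher_deriv_shift_0[of N bose "s + 2 * of_real pi * \<i>"] higher_deriv_shift_0[of N bose s])
qed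

lemma bose_deriv_sums_nome:
  assumes "Im z > 0"
  shows "(\<lambda>r. of_nat r ^ N * nome z ^ r) sums (deriv ^^ N) bose (2 * of_real pi * \<i> * z)"
  unfolding nome_def using assms by (intro bose_deriv_sums) (simp add: mult_pos_pos)

context
  fixes \<tau> :: complex and N :: nat
  assumes \<tau>: "Im \<tau> > 0" and N: "odd N"
begin

lemma norm_nome_tau: "norm (nome \<tau>) < 1"
  using \<tau> by (simp add: norm_nome_less_1_iff)

lemma N_pos: "N > 0"
  using N by (rule odd_pos)

lemma power_coeff: "(of_nat 0 ^ N :: complex) = 0" "norm (of_nat r ^ N :: complex) \<le> of_nat r ^ N"
  using N_pos by (simp_all add: norm_power)

lemma higher_deriv_bose_even:
  assumes "z \<notin> \<int>"
  shows "(deriv ^^ N) bose (2 * of_real pi * \<i> * (- z)) = (deriv ^^ N) bose (2 * of_real pi * \<i> * z)"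
  using higher_deriv_bose_uminus[of "2 * of_real pi * \<i> * z" N] assms N N_pos nome_eq_1_iff[of z]
  by (simp add: nome_def)

lemma elliptic_series_holomorphic: "elliptic_series N \<tau> holomorphic_on ({z. \<bar>Im z\<bar> < Im \<tau>} - \<int>)"
proof -
  have "(deriv ^^ N) bose analytic_on {s. exp s \<noteq> 1}"
    by (subst analytic_on_analytic_at) (auto intro: higher_deriv_bose_analytic)
  then have hol: "(deriv ^^ N) bose holomorphic_on {s. exp s \<noteq> 1}" by (rule analytic_imp_holomorphic)
  have "(\<lambda>z. (deriv ^^ N) bose (2 * of_real pi * \<i> * z)) holomorphic_on ({z. \<bar>Im z\<bar> < Im \<tau>} - \<int>)"
    by (rule holomorphic_on_compose_gen[OF _ hol, unfolded o_def])
       (auto intro!: holomorphic_intros simp: nome_eq_1_iff simp flip: nome_def)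
  then show ?thesis
    unfolding elliptic_series_def
    by (intro holomorphic_on_add holomorphic_on_subset[OF lambert_nome_holomorphic(1)[OF \<tau> power_coeff]]
      holomorphic_on_subset[OF lambert_nome_holomorphic(2)[OF \<tau> power_coeff]]) auto
qed

lemma elliptic_series_plus_1: "elliptic_series N \<tau> (z + 1) = elliptic_series N \<tau> z"
proof -
  have "nome (- (z + 1)) = nome (- z)" "nome (z + 1) = nome z"
    unfolding nome_minus nome_add by simp_all
  moreover have "(deriv ^^ N) bose (2 * of_real pi * \<i> * (z + 1)) = (deriv ^^ N) bose (2 * of_real pi * \<i> * z)"
    using higher_deriv_bose_plus_2pi[of N "2 * of_real pi * \<i> * z"] by (simp add: ring_distribs)
  ultimately show ?thesis by (simp only: elliptic_series_def)
qed

lemma lambert_diff_eq_bose: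
  assumes "- Im \<tau> < Im z"
  shows "lambert (\<lambda>r. of_nat r ^ N) (nome \<tau>) (nome z) - lambert (\<lambda>r. of_nat r ^ N) (nome \<tau>) (nome (z + \<tau>)) =
    (deriv ^^ N) bose (2 * of_real pi * \<i> * (z + \<tau>))"
proof -
  have "norm (nome \<tau> * nome z) < 1" using assms by (simp add: norm_nome_mult_nome_less_1_iff)
  from lambert_functional_equation[OF norm_nome_tau power_coeff this]
  have "(\<lambda>r. of_nat r ^ N * nome (z + \<tau>) ^ r) sums
      (lambert (\<lambda>r. of_nat r ^ N) (nome \<tau>) (nome z) - lambert (\<lambda>r. of_nat r ^ N) (nome \<tau>) (nome (z + \<tau>)))"
    by (simp add: nome_add mult.commute)
  moreover have "(\<lambda>r. of_nat r ^ N * nome (z + \<tau>) ^ r) sums (deriv ^^ N) bose (2 * of_real pi * \<i> * (z + \<tau>))"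
    using assms by (intro bose_deriv_sums_nome) simp
  ultimately show ?thesis by (rule sums_unique2)
qed

text \<open>The Lambert series in zeta loses the derivative of \<open>bose\<close> at z + tau, which
  the first summand supplies; the one in 1 / zeta gains the derivative at - z, which by evenness is
  the one at z.\<close>

lemma elliptic_series_plus_tau:
  assumes "- Im \<tau> < Im z" "Im z < 0"
  shows "elliptic_series N \<tau> (z + \<tau>) = elliptic_series N \<tau> z"
proof -
  have "z \<notin> \<int>" using assms by (auto elim!: Ints_cases)
  have 1: "lambert (\<lambda>r. of_nat r ^ N) (nome \<tau>) (nome z) - lambert (\<lambda>r. of_nat r ^ N) (nome \<tau>) (nome (z + \<tau>)) =
      (deriv ^^ N) bose (2 * of_real pi * \<i> * (z + \<tau>))"
    using assms by (intro lambert_diff_eq_bose) simp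
  have "lambert (\<lambda>r. of_nat r ^ N) (nome \<tau>) (nome (- (z + \<tau>))) - lambert (\<lambda>r. of_nat r ^ N) (nome \<tau>) (nome (- z)) =
      (deriv ^^ N) bose (2 * of_real pi * \<i> * (- z))"
    using lambert_diff_eq_bose[of "- (z + \<tau>)"] assms by simp
  then show ?thesis using 1 unfolding higher_deriv_bose_even[OF \<open>z \<notin> \<int>\<close>] elliptic_series_def
    by (simp add: algebra_simps)
qed

text \<open>Each Lambert series contributes one divisor sum at w = 1. With k = N + 1 the limit is -
  B_k / k times E_k.\<close>

lemma elliptic_series_limit:
  "((\<lambda>z. elliptic_series N \<tau> z - fact N / (2 * of_real pi * \<i> * z) ^ Suc N) \<longlongrightarrow>
      - of_real (bernoulli_number (Suc N)) / of_nat (Suc N) +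
      2 * (\<Sum>\<^sub>\<infinity>l\<in>{1..}. of_nat (divisor_power_sum N l) * nome \<tau> ^ l)) (at 0)"
proof -
  define lam where "lam = lambert (\<lambda>r. of_nat r ^ N) (nome \<tau>)"
  have lam1: "lam 1 = (\<Sum>\<^sub>\<infinity>l\<in>{1..}. of_nat (divisor_power_sum N l) * nome \<tau> ^ l)"
    unfolding lam_def using lambert_eq_divisor_sum[OF norm_nome_tau N_pos] by (simp add: infsumI)
  define g where "g z = lam (nome z) + lam (nome (- z))" for z
  have "g holomorphic_on {z. \<bar>Im z\<bar> < Im \<tau>}"
    unfolding g_def lam_def
    by (intro holomorphic_on_add holomorphic_on_subset[OF lambert_nome_holomorphic(1)[OF \<tau> power_coeff]]
      holomorphic_on_subset[OF lambert_nome_holomorphic(2)[OF \<tau> power_coeff]]) auto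
  then have "isCont g 0"
    using continuous_on_eq_continuous_at[OF open_strip[of "Im \<tau>"], of g] holomorphic_on_imp_continuous_on \<tau>
    by auto
  then have g: "(g \<longlongrightarrow> 2 * lam 1) (at 0)" by (simp add: isCont_def g_def)
  have "filterlim (\<lambda>z. 2 * of_real pi * \<i> * z) (at 0) (at (0 :: complex))"
    by (rule filterlim_atI) (auto intro!: tendsto_eq_intros simp: eventually_at_filter)
  from filterlim_compose[OF higher_deriv_bose_limit[OF N] this]
  have "((\<lambda>z. (deriv ^^ N) bose (2 * of_real pi * \<i> * z) - fact N / (2 * of_real pi * \<i> * z) ^ Suc N) \<longlongrightarrow>
      - of_real (bernoulli_number (Suc N)) / of_nat (Suc N)) (at 0)" .
  from tendsto_add[OF this g] show ?thesis
    by (simp add: elliptic_series_def g_def lam_def[symmetric] lam1 algebra_simps del: power_Suc of_nat_Suc)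
qed

lemma elliptic_series_fourier:
  assumes "0 < Im z" "Im z < Im \<tau>"
  shows "((\<lambda>r. of_int r ^ N / (1 - nome \<tau> powi r) * nome z powi r) has_sum elliptic_series N \<tau> z) UNIV"
proof -
  define q where "q = nome \<tau>"
  define t where "t = (\<lambda>r w. of_nat r ^ N * q ^ r / (1 - q ^ r) * w ^ r)"
  have q: "norm q < 1" unfolding q_def by (rule norm_nome_tau)
  have q_ne: "q ^ n \<noteq> 1" if "n > 0" for n
    using q that by (metis norm_one norm_power order_less_irrefl power_less_one_iff norm_ge_zero)
  have lam: "(t' has_sum lambert (\<lambda>r. of_nat r ^ N) q w) UNIV" if "norm (q * w) < 1" "t' = (\<lambda>r. t r w)" for w t'
    unfolding that(2) t_def
    by (intro norm_summable_imp_has_sum lambert_summable_norm[OF q power_coeff that(1)]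
        lambert_sums[OF q power_coeff that(1)])
  have bose: "((\<lambda>r. of_nat r ^ N * nome z ^ r) has_sum (deriv ^^ N) bose (2 * of_real pi * \<i> * z)) UNIV"
  proof (rule norm_summable_imp_has_sum)
    show "summable (\<lambda>r. norm (of_nat r ^ N * nome z ^ r))"
      using summable_of_nat_power_mult_power[of "norm (nome z)" N] assms
      by (simp add: norm_mult norm_power norm_nome_less_1_iff)
  qed (use assms in \<open>intro bose_deriv_sums_nome\<close>)
  have pos: "((\<lambda>n. of_int (int n) ^ N / (1 - q powi int n) * nome z powi int n) has_sum
      ((deriv ^^ N) bose (2 * of_real pi * \<i> * z) + lambert (\<lambda>r. of_nat r ^ N) q (nome z))) UNIV"
  proof -
    have "norm (q * nome z) < 1" using assms \<tau> unfolding q_def by (simp add: norm_nome_mult_nome_less_1_iff)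
    from has_sum_add[OF bose lam[OF this refl]]
    have "((\<lambda>n. of_nat n ^ N * nome z ^ n + t n (nome z)) has_sum
        ((deriv ^^ N) bose (2 * of_real pi * \<i> * z) + lambert (\<lambda>r. of_nat r ^ N) q (nome z))) UNIV" .
    moreover have "of_nat n ^ N * nome z ^ n + t n (nome z) =
        of_int (int n) ^ N / (1 - q powi int n) * nome z powi int n" for n
    proof (cases "n = 0")
      case False
      then show ?thesis using q_ne[of n] by (simp add: t_def field_simps)
    qed (use N_pos in \<open>simp add: t_def\<close>)
    ultimately show ?thesis by simp
  qed
  have neg: "((\<lambda>n. of_int (- 1 - int n) ^ N / (1 - q powi (- 1 - int n)) * nome z powi (- 1 - int n)) has_sum
      lambert (\<lambda>r. of_nat r ^ N) q (nome (- z))) UNIV"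
  proof -
    have "norm (q * nome (- z)) < 1" using assms unfolding q_def by (simp add: norm_nome_mult_nome_less_1_iff)
    from lam[OF this refl] have "((\<lambda>r. t r (nome (- z))) has_sum lambert (\<lambda>r. of_nat r ^ N) q (nome (- z))) UNIV" .
    \<comment> \<open>The Lambert series starts at r = 0 and the negative frequencies at -1, so the
      zero term is dropped before reindexing.\<close>
    moreover have "t n (nome (- z)) = 0" if "n \<notin> range Suc" for n
      using that by (cases n) (auto simp: t_def)
    ultimately have "((\<lambda>r. t r (nome (- z))) has_sum lambert (\<lambda>r. of_nat r ^ N) q (nome (- z))) (range Suc)"
      by (subst has_sum_cong_neutral[of UNIV _ "\<lambda>r. t r (nome (- z))"])
         auto
    then have "((\<lambda>n. t (Suc n) (nome (- z))) has_sum lambert (\<lambda>r. of_nat r ^ N) q (nome (- z))) UNIV"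
      by (subst (asm) has_sum_reindex) (auto simp: o_def)
    moreover have "t (Suc n) (nome (- z)) =
        of_int (- 1 - int n) ^ N / (1 - q powi (- 1 - int n)) * nome z powi (- 1 - int n)" for n
    proof -
      have m: "- 1 - int n = - int (Suc n)" by simp
      have "q ^ Suc n \<noteq> 0" "q ^ Suc n \<noteq> 1" using q_ne[of "Suc n"] by (auto simp: q_def)
      then have "- 1 / (1 - inverse (q ^ Suc n)) = q ^ Suc n / (1 - q ^ Suc n)"
        by (simp add: divide_simps del: power_Suc) (simp add: algebra_simps del: power_Suc)
      moreover have "of_int (- int (Suc n)) ^ N = - (of_nat (Suc n) ^ N :: complex)"
        using N by (simp add: power_minus_odd del: of_nat_Suc)
      ultimately show ?thesis unfolding m t_def power_int_minus power_int_of_nat nome_minus power_inverse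
        by (metis (no_types, lifting) minus_divide_left mult.commute mult_1 mult_minus_left times_divide_eq_left times_divide_eq_right)
    qed
    ultimately show ?thesis by simp
  qed
  have "((\<lambda>r. of_int r ^ N / (1 - q powi r) * nome z powi r) has_sum
      ((deriv ^^ N) bose (2 * of_real pi * \<i> * z) + lambert (\<lambda>r. of_nat r ^ N) q (nome z) +
        lambert (\<lambda>r. of_nat r ^ N) q (nome (- z)))) UNIV"
    by (rule has_sum_int_split[OF pos neg])
  then show ?thesis by (simp add: elliptic_series_def q_def)
qed

end

section \<open>The quotient of theta functions and its Laurent expansion\<close>

text \<open>Modular behaviour is studied for the quotient and not for its m-th power: the pole is
  simple, so matching one residue is enough.\<close>

definition theta_ratio :: "complex \<Rightarrow> complex \<Rightarrow> complex" where
  "theta_ratio z \<tau> = jacobi_theta (z + 1/2) \<tau> / jacobi_theta z \<tau>"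

lemma phi_altdef: "phi m z \<tau> = theta_ratio z \<tau> ^ m"
  by (simp add: phi_def theta_ratio_def)

lemma theta_ratio_plus_1: "theta_ratio (z + 1) \<tau> = theta_ratio z \<tau>"
proof -
  have "z + 1 + 1/2 = (z + 1/2) + 1" by simp
  then have "jacobi_theta (z + 1 + 1/2) \<tau> = - jacobi_theta (z + 1/2) \<tau>" by (simp only: jacobi_theta_plus_1)
  then show ?thesis by (simp add: theta_ratio_def jacobi_theta_plus_1)
qed

lemma theta_ratio_plus_tau: "theta_ratio (z + \<tau>) \<tau> = - theta_ratio z \<tau>"
proof -
  have "exp (- (of_real pi * \<i> * \<tau>) - 2 * of_real pi * \<i> * (z + 1/2)) =
      exp (- (of_real pi * \<i> * \<tau>) - 2 * of_real pi * \<i> * z - of_real pi * \<i>)"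
    by (rule arg_cong[where f = exp]) (simp add: algebra_simps)
  also have "\<dots> = - exp (- (of_real pi * \<i> * \<tau>) - 2 * of_real pi * \<i> * z)"
    by (simp add: exp_diff)
  finally show ?thesis
    using jacobi_theta_plus_tau[of "z + 1/2" \<tau>]
    by (simp add: theta_ratio_def jacobi_theta_plus_tau add.assoc add.commute[of \<tau>])
qed

lemma theta_ratio_uminus: "theta_ratio (- z) \<tau> = - theta_ratio z \<tau>"
proof -
  have "jacobi_theta (- z + 1/2) \<tau> = - jacobi_theta (z - 1/2) \<tau>"
    using jacobi_theta_uminus[of "z - 1/2" \<tau>] by simp
  also have "\<dots> = jacobi_theta (z + 1/2) \<tau>"
    using jacobi_theta_plus_1[of "z - 1/2" \<tau>] by (simp add: add.commute)
  finally show ?thesis by (simp add: theta_ratio_def jacobi_theta_uminus)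
qed

text \<open>The two quotients telescope to theta(z + 1) / theta(z).\<close>

lemma theta_ratio_half_period:
  assumes "jacobi_theta z \<tau> \<noteq> 0" "jacobi_theta (z + 1/2) \<tau> \<noteq> 0"
  shows "theta_ratio z \<tau> * theta_ratio (z + 1/2) \<tau> = - 1"
  using assms jacobi_theta_plus_1[of z \<tau>] by (simp add: theta_ratio_def add.assoc)

definition theta_fps :: "complex \<Rightarrow> complex \<Rightarrow> complex fps" where
  "theta_fps a \<tau> = Abs_fps (\<lambda>n. theta_deriv n a \<tau> / fact n)"

text \<open>The Taylor series at 0 of z times the quotient: the shift removes the simple zero of the
  denominator. Its coefficients are built from the \<open>theta_deriv\<close>, so their dependence
  on tau is explicit.\<close>

definition theta_ratio_fps :: "complex \<Rightarrow> complex fps" where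
  "theta_ratio_fps \<tau> = theta_fps (1/2) \<tau> * inverse (fps_shift 1 (theta_fps 0 \<tau>))"

lemma theta_has_fps_expansion:
  assumes "Im \<tau> > 0"
  shows "(\<lambda>z. jacobi_theta (z + a) \<tau>) has_fps_expansion theta_fps a \<tau>"
proof -
  have "(\<lambda>z. jacobi_theta (z + a) \<tau>) holomorphic_on UNIV"
    by (rule holomorphic_on_compose_gen[of "\<lambda>z. z + a" UNIV "\<lambda>z. jacobi_theta z \<tau>" UNIV, unfolded o_def])
       (auto intro!: holomorphic_intros jacobi_theta_holomorphic assms)
  then have "(\<lambda>z. jacobi_theta (z + a) \<tau>) has_fps_expansion fps_expansion (\<lambda>z. jacobi_theta (z + a) \<tau>) 0"
    by (intro has_fps_expansion_fps_expansion[of UNIV]) auto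
  moreover have "(deriv ^^ n) (\<lambda>z. jacobi_theta (z + a) \<tau>) = (\<lambda>z. theta_deriv n (z + a) \<tau>)" for n
  proof (induction n)
    case (Suc n)
    have "deriv (\<lambda>z. theta_deriv n (z + a) \<tau>) z = theta_deriv (Suc n) (z + a) \<tau>" for z
      using theta_deriv_has_field_derivative[OF assms, of n "z + a"]
      by (intro DERIV_imp_deriv) (simp add: DERIV_shift)
    then show ?case using Suc by auto
  qed (simp add: theta_deriv_0)
  ultimately show ?thesis by (simp add: fps_expansion_def theta_fps_def)
qed

lemma theta_fps_nth_0: "fps_nth (theta_fps a \<tau>) 0 = jacobi_theta a \<tau>"
  by (simp add: theta_fps_def theta_deriv_0)

lemma theta_ratio_has_laurent_expansion:
  assumes "Im \<tau> > 0"
  shows "(\<lambda>z. theta_ratio z \<tau>) has_laurent_expansion fls_shift 1 (fps_to_fls (theta_ratio_fps \<tau>))"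
proof -
  define B where "B = fps_shift 1 (theta_fps 0 \<tau>)"
  have "fps_nth (theta_fps 0 \<tau>) 0 = 0" by (simp add: theta_fps_nth_0 jacobi_theta_0)
  then have "theta_fps 0 \<tau> = B * fps_X"
    unfolding B_def by (intro fps_ext) (auto simp: fps_X_mult_right_nth)
  then have eq: "fps_to_fls (theta_fps 0 \<tau>) = fps_to_fls B * fls_X" by (simp add: fls_times_fps_to_fls)
  have "fps_nth B 0 \<noteq> 0" using theta_deriv_1_nonzero[OF assms] by (simp add: B_def theta_fps_def)
  then have inv: "inverse (fps_to_fls B) = fps_to_fls (inverse B)"
    by (intro fls_inverse_fps_to_fls) simp
  have "(\<lambda>z. jacobi_theta (z + 1/2) \<tau> / jacobi_theta (z + 0) \<tau>) has_laurent_expansion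
      fps_to_fls (theta_fps (1/2) \<tau>) / fps_to_fls (theta_fps 0 \<tau>)"
    using theta_has_fps_expansion[OF assms]
    by (intro has_laurent_expansion_divide has_laurent_expansion_fps)
  also have "fps_to_fls (theta_fps (1/2) \<tau>) / fps_to_fls (theta_fps 0 \<tau>) = fls_shift 1 (fps_to_fls (theta_ratio_fps \<tau>))"
  proof -
    have "inverse (fps_to_fls (theta_fps 0 \<tau>)) = fps_to_fls (inverse B) * fls_X_inv"
      unfolding eq inverse_mult_distrib inv fls_inverse_X ..
    then show ?thesis
      unfolding theta_ratio_fps_def B_def[symmetric] divide_inverse fls_times_fps_to_fls
        fls_X_inv_times_conv_shift(2)[symmetric] by (simp only: mult.assoc)
  qed
  finally show ?thesis by (simp add: theta_ratio_def[abs_def])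
qed

lemma phi_has_laurent_expansion:
  assumes "Im \<tau> > 0"
  shows "(\<lambda>z. phi m z \<tau>) has_laurent_expansion fls_shift (int m) (fps_to_fls (theta_ratio_fps \<tau> ^ m))"
  using has_laurent_expansion_power[OF theta_ratio_has_laurent_expansion[OF assms], of m]
  by (simp add: phi_altdef[abs_def] fls_shifted_pow fps_to_fls_power)

lemma D_altdef:
  assumes "Im \<tau> > 0" "k \<le> m"
  shows "D m k \<tau> = (2 * of_real pi * \<i>) ^ k * fps_nth (theta_ratio_fps \<tau> ^ m) (m - k)"
  unfolding D_def laurent_expansion_0_eqI[OF phi_has_laurent_expansion[OF assms(1)]]
  using assms(2) by (simp add: nat_diff_distrib')

section \<open>Holomorphic dependence of the Laurent coefficients on tau\<close>

definition holomorphic_coeffs :: "(complex \<Rightarrow> complex fps) \<Rightarrow> complex set \<Rightarrow> bool" where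
  "holomorphic_coeffs F A \<longleftrightarrow> (\<forall>n. (\<lambda>\<tau>. fps_nth (F \<tau>) n) holomorphic_on A)"

lemma holomorphic_coeffs_mult:
  "holomorphic_coeffs F A \<Longrightarrow> holomorphic_coeffs G A \<Longrightarrow> holomorphic_coeffs (\<lambda>\<tau>. F \<tau> * G \<tau>) A"
  unfolding holomorphic_coeffs_def fps_mult_nth by (intro allI holomorphic_intros) auto

lemma holomorphic_coeffs_power:
  "holomorphic_coeffs F A \<Longrightarrow> holomorphic_coeffs (\<lambda>\<tau>. F \<tau> ^ n) A"
proof (induction n)
  case 0
  then show ?case by (simp add: holomorphic_coeffs_def)
qed (simp add: holomorphic_coeffs_mult)

text \<open>Solving F * inverse F = 1 for the n-th coefficient of the inverse divides only by the
  constant term of F and uses earlier coefficients.\<close>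

lemma holomorphic_coeffs_inverse:
  assumes F: "holomorphic_coeffs F A" and nz: "\<And>\<tau>. \<tau> \<in> A \<Longrightarrow> fps_nth (F \<tau>) 0 \<noteq> 0"
  shows "holomorphic_coeffs (\<lambda>\<tau>. inverse (F \<tau>)) A"
  unfolding holomorphic_coeffs_def
proof
  fix n
  show "(\<lambda>\<tau>. fps_nth (inverse (F \<tau>)) n) holomorphic_on A"
  proof (induction n rule: less_induct)
    case (less n)
    have "(\<lambda>\<tau>. ((if n = 0 then 1 else 0) - (\<Sum>i=1..n. fps_nth (F \<tau>) i * fps_nth (inverse (F \<tau>)) (n - i))) / fps_nth (F \<tau>) 0)
        holomorphic_on A"
      using F nz less by (intro holomorphic_intros) (auto simp: holomorphic_coeffs_def)
    then show ?case
    proof (rule holomorphic_transform)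
      fix \<tau> assume "\<tau> \<in> A"
      have "fps_nth (F \<tau> * inverse (F \<tau>)) n = (if n = 0 then 1 else 0)"
        using nz[OF \<open>\<tau> \<in> A\<close>] by (simp add: inverse_mult_eq_1')
      then have "fps_nth (F \<tau>) 0 * fps_nth (inverse (F \<tau>)) n +
          (\<Sum>i=1..n. fps_nth (F \<tau>) i * fps_nth (inverse (F \<tau>)) (n - i)) = (if n = 0 then 1 else 0)"
        unfolding fps_mult_nth by (simp add: sum.atLeast_Suc_atMost[of 0])
      then show "((if n = 0 then 1 else 0) - (\<Sum>i=1..n. fps_nth (F \<tau>) i * fps_nth (inverse (F \<tau>)) (n - i))) / fps_nth (F \<tau>) 0 =
          fps_nth (inverse (F \<tau>)) n"
        using nz[OF \<open>\<tau> \<in> A\<close>] by (simp add: field_simps)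
    qed
  qed
qed

lemma D_holomorphic:
  assumes "k \<le> m"
  shows "D m k holomorphic_on upper_half_plane"
proof -
  have theta: "holomorphic_coeffs (theta_fps a) upper_half_plane" for a
    unfolding holomorphic_coeffs_def theta_fps_def
    by (auto intro!: holomorphic_intros theta_deriv_holomorphic)
  then have "holomorphic_coeffs (\<lambda>\<tau>. fps_shift 1 (theta_fps 0 \<tau>)) upper_half_plane"
    by (simp add: holomorphic_coeffs_def)
  then have "holomorphic_coeffs (\<lambda>\<tau>. inverse (fps_shift 1 (theta_fps 0 \<tau>))) upper_half_plane"
    by (rule holomorphic_coeffs_inverse) (use theta_deriv_1_nonzero in \<open>simp add: theta_fps_def\<close>)
  then have "holomorphic_coeffs (\<lambda>\<tau>. theta_ratio_fps \<tau> ^ m) upper_half_plane"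
    unfolding theta_ratio_fps_def by (intro holomorphic_coeffs_power holomorphic_coeffs_mult theta)
  then have "(\<lambda>\<tau>. (2 * of_real pi * \<i>) ^ k * fps_nth (theta_ratio_fps \<tau> ^ m) (m - k)) holomorphic_on upper_half_plane"
    unfolding holomorphic_coeffs_def by (intro holomorphic_intros) auto
  then show ?thesis
    by (rule holomorphic_transform) (use assms in \<open>simp add: D_altdef\<close>)
qed

text \<open>The choice c = -1 yields parity, and c = 1 / (c tau + d), with the matrix entries c and
  d, yields the weight.\<close>

lemma has_laurent_expansion_scale:
  assumes "f has_laurent_expansion F" "c \<noteq> (0 :: complex)"
  shows "(\<lambda>z. f (c * z)) has_laurent_expansion fls_compose_fps F (fps_const c * fps_X)"
proof -
  have "(\<lambda>z. c * z) has_fps_expansion fps_const c * fps_X"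
    by (intro fps_expansion_intros)
  then have "(\<lambda>z. c * z) has_laurent_expansion fps_to_fls (fps_const c * fps_X)"
    by (rule has_laurent_expansion_fps)
  from has_laurent_expansion_compose[OF assms(1) this] show ?thesis
    using assms(2) by (simp add: o_def)
qed

lemma phi_laurent_coeff_odd:
  assumes "Im \<tau> > 0" "even m" "odd k"
  shows "fls_nth (fls_shift (int m) (fps_to_fls (theta_ratio_fps \<tau> ^ m))) k = 0"
proof -
  define F where "F = fls_shift (int m) (fps_to_fls (theta_ratio_fps \<tau> ^ m))"
  have F: "(\<lambda>z. phi m z \<tau>) has_laurent_expansion F"
    unfolding F_def by (rule phi_has_laurent_expansion[OF assms(1)])
  have "(\<lambda>z. phi m ((- 1) * z) \<tau>) has_laurent_expansion fls_compose_fps F (fps_const (- 1) * fps_X)"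
    by (rule has_laurent_expansion_scale[OF F]) simp
  moreover have "phi m ((- 1) * z) \<tau> = phi m z \<tau>" for z
    using assms(2) by (simp add: phi_altdef theta_ratio_uminus)
  ultimately have "(\<lambda>z. phi m z \<tau>) has_laurent_expansion fls_compose_fps F (fps_const (- 1) * fps_X)"
    by (simp only:)
  then have eq: "fls_compose_fps F (fps_const (- 1) * fps_X) = F"
    using F by (rule has_laurent_expansion_unique)
  have "fls_nth F k = fls_nth F k * (- 1) powi k"
    using fls_nth_fls_compose_fps_linear[of "- 1 :: complex" F k] unfolding eq by simp
  then show ?thesis using assms(3) by (simp add: F_def power_int_minus_left_odd)
qed

text \<open>Evenness removes the coefficient of z, so the remainder has order 2 and not merely 1.
  The alternative \<open>G = 0\<close> appears because the zero series has subdegree 0.\<close>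

lemma phi_minus_principal_part_has_laurent_expansion:
  assumes \<tau>: "Im \<tau> > 0" and m: "even m"
  obtains G where
    "(\<lambda>z. phi m z \<tau> - (\<Sum>j=0..m div 2. D m (2 * j) \<tau> / (2 * of_real pi * \<i> * z) ^ (2 * j))) has_laurent_expansion G"
    "fls_subdegree G \<ge> 2 \<or> G = 0"
proof -
  define F where "F = fls_shift (int m) (fps_to_fls (theta_ratio_fps \<tau> ^ m))"
  have F: "(\<lambda>z. phi m z \<tau>) has_laurent_expansion F"
    unfolding F_def by (rule phi_has_laurent_expansion[OF \<tau>])
  define d where "d j = D m (2 * j) \<tau> / (2 * of_real pi * \<i>) ^ (2 * j)" for j
  have d: "d j = fls_nth F (- int (2 * j))" if "j \<le> m div 2" for j
  proof -
    from that have "2 * j \<le> m" by simp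
    then have "\<not> int m < 2 * int j" "nat (int m - 2 * int j) = m - 2 * j" by auto
    then show ?thesis using \<open>2 * j \<le> m\<close> \<tau> by (simp add: d_def D_altdef F_def)
  qed
  define G where "G = F - (\<Sum>j=0..m div 2. fls_const (d j) * fls_X_inv ^ (2 * j))"
  have "(\<lambda>z. \<Sum>j=0..m div 2. d j * inverse z ^ (2 * j)) has_laurent_expansion
      (\<Sum>j=0..m div 2. fls_const (d j) * fls_X_inv ^ (2 * j))"
    by (intro has_laurent_expansion_sum has_laurent_expansion_cmult_left has_laurent_expansion_power
        has_laurent_expansion_fls_X_inv)
  from has_laurent_expansion_diff[OF F this]
  have "(\<lambda>z. phi m z \<tau> - (\<Sum>j=0..m div 2. d j * inverse z ^ (2 * j))) has_laurent_expansion G"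
    unfolding G_def .
  also have "(\<lambda>z. \<Sum>j=0..m div 2. d j * inverse z ^ (2 * j)) =
      (\<lambda>z. \<Sum>j=0..m div 2. D m (2 * j) \<tau> / (2 * of_real pi * \<i> * z) ^ (2 * j))"
  proof (intro ext sum.cong refl)
    fix z j
    show "d j * inverse z ^ (2 * j) = D m (2 * j) \<tau> / (2 * of_real pi * \<i> * z) ^ (2 * j)"
      unfolding d_def power_mult_distrib[of "2 * of_real pi * \<i>" z] power_inverse by (simp add: divide_inverse)
  qed
  finally have G: "(\<lambda>z. phi m z \<tau> - (\<Sum>j=0..m div 2. D m (2 * j) \<tau> / (2 * of_real pi * \<i> * z) ^ (2 * j)))
      has_laurent_expansion G" .
  have nth: "fls_nth G k = fls_nth F k - (\<Sum>j=0..m div 2. if k = - int (2 * j) then d j else 0)" for k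
    by (simp add: G_def fls_nth_sum if_distrib cong: if_cong)
  have "fls_nth G k = 0" if "k < 2" for k
  proof (cases "odd k")
    case True
    then have "(\<Sum>j=0..m div 2. if k = - int (2 * j) then d j else 0) = 0" by (intro sum.neutral) auto
    then show ?thesis using phi_laurent_coeff_odd[OF \<tau> m True] unfolding nth F_def by simp
  next
    case False
    then obtain l where l: "k = 2 * l" by auto
    define i where "i = nat (- l)"
    have k: "k = - int (2 * i)" using that l by (auto simp: i_def)
    have "(\<Sum>j=0..m div 2. if k = - int (2 * j) then d j else 0) = (\<Sum>j=0..m div 2. if j = i then d j else 0)"
      unfolding k by (intro sum.cong) auto
    also have "\<dots> = (if i \<le> m div 2 then d i else 0)" by simp
    also have "\<dots> = fls_nth F k"
    proof (cases "i \<le> m div 2")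
      case False
      then have "int (2 * i) > int m" by simp
      then show ?thesis using False by (simp add: F_def k)
    qed (simp add: d k)
    finally show ?thesis unfolding nth by simp
  qed
  then have "fls_subdegree G \<ge> 2 \<or> G = 0" by (metis fls_subdegree_geI)
  with G show ?thesis by (rule that)
qed

lemma phi_laurent_bigo:
  assumes \<tau>: "Im \<tau> > 0" and m: "even m"
  shows "(\<lambda>z. phi m z \<tau> - (\<Sum>j=0..m div 2. D m (2 * j) \<tau> / (2 * of_real pi * \<i> * z) ^ (2 * j)))
          \<in> O[at 0](\<lambda>z. z ^ 2)" (is "?R \<in> _")
proof -
  obtain G where G: "?R has_laurent_expansion G" "fls_subdegree G \<ge> 2 \<or> G = 0"
    by (rule phi_minus_principal_part_has_laurent_expansion[OF assms])
  from G(2) have sd: "fls_subdegree (fls_shift 2 G) \<ge> 0" by (cases "G = 0") auto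
  have "(\<lambda>z. ?R z * z powi (- 2)) \<midarrow>0\<rightarrow> fls_nth (fls_shift 2 G) 0"
    by (rule has_laurent_expansion_imp_tendsto_0[OF has_laurent_expansion_shift'[OF G(1)] sd])
  moreover have "z powi (- 2) = inverse (z ^ 2)" for z :: complex
    by (simp add: power_int_minus)
  ultimately have "(\<lambda>z. ?R z / z ^ 2) \<midarrow>0\<rightarrow> fls_nth (fls_shift 2 G) 0" by (simp only: divide_inverse)
  then show ?thesis by (rule bigoI_tendsto) (simp add: eventually_at_filter)
qed

lemma phi_minus_principal_part_limit:
  assumes \<tau>: "Im \<tau> > 0" and m: "even m"
  shows "((\<lambda>z. phi m z \<tau> - (\<Sum>j=1..m div 2. D m (2 * j) \<tau> / (2 * of_real pi * \<i> * z) ^ (2 * j))) \<longlongrightarrow> D m 0 \<tau>) (at 0)"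
proof -
  let ?R = "\<lambda>z. phi m z \<tau> - (\<Sum>j=0..m div 2. D m (2 * j) \<tau> / (2 * of_real pi * \<i> * z) ^ (2 * j))"
  obtain G where G: "?R has_laurent_expansion G" "fls_subdegree G \<ge> 2 \<or> G = 0"
    by (rule phi_minus_principal_part_has_laurent_expansion[OF assms])
  from G(2) have "fls_subdegree G \<ge> 0" "fls_nth G 0 = 0" by auto
  then have "?R \<midarrow>0\<rightarrow> 0" using has_laurent_expansion_imp_tendsto_0[OF G(1)] by simp
  from tendsto_add[OF this tendsto_const[of "D m 0 \<tau>"]] show ?thesis
    by (simp add: sum.atLeast_Suc_atMost[of 0])
qed

section \<open>The Fourier expansion\<close>

lemma has_sum_finite_sum:
  fixes f :: "'i \<Rightarrow> 'b \<Rightarrow> 'a :: {topological_comm_monoid_add}"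
  assumes "finite I" "\<And>i. i \<in> I \<Longrightarrow> (f i has_sum s i) A"
  shows "((\<lambda>x. \<Sum>i\<in>I. f i x) has_sum (\<Sum>i\<in>I. s i)) A"
  using assms
proof (induction I rule: finite_induct)
  case (insert i I)
  then have "((\<lambda>x. f i x + (\<Sum>i\<in>I. f i x)) has_sum (s i + (\<Sum>i\<in>I. s i))) A"
    by (intro has_sum_add) auto
  then show ?case using insert by simp
qed auto

lemma theta_ratio_holomorphic:
  assumes "Im \<tau> > 0"
  shows "(\<lambda>z. theta_ratio z \<tau>) holomorphic_on ({z. \<bar>Im z\<bar> < Im \<tau>} - \<int>)"
proof -
  have nz: "jacobi_theta z \<tau> \<noteq> 0" if "z \<in> {z. \<bar>Im z\<bar> < Im \<tau>} - \<int>" for z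
  proof
    assume "jacobi_theta z \<tau> = 0"
    then obtain a b where ab: "z = of_int a + of_int b * \<tau>" using jacobi_theta_eq_0_iff[OF assms] by blast
    then have "\<bar>of_int b\<bar> * Im \<tau> < 1 * Im \<tau>" using that assms by (simp add: abs_mult)
    then have "\<bar>real_of_int b\<bar> < 1" using assms by (simp add: mult_less_cancel_right)
    then have "b = 0" by linarith
    then show False using that ab by simp
  qed
  have "(\<lambda>z. jacobi_theta (z + 1/2) \<tau>) holomorphic_on A" for A
    by (rule holomorphic_on_compose_gen[of "\<lambda>z. z + 1/2" A "\<lambda>z. jacobi_theta z \<tau>" UNIV, unfolded o_def])
       (auto intro!: holomorphic_intros jacobi_theta_holomorphic assms)
  then show ?thesis unfolding theta_ratio_def using nz
    by (intro holomorphic_on_divide jacobi_theta_holomorphic assms) auto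
qed

definition chi_0 :: "nat \<Rightarrow> complex \<Rightarrow> complex" where
  "chi_0 m \<tau> = D m 0 \<tau> + (\<Sum>j=1..m div 2. of_real (bernoulli_number (2 * j)) / fact (2 * j) *
     D m (2 * j) \<tau> * eisenstein_E (2 * j) \<tau>)"

text \<open>Dividing by (2j - 1)! normalises the pole of each elliptic series to 1 / (2 pi i
  z)^(2j). The difference is then constant, and its value is its limit at 0: the constant term of
  \<open>phi\<close> minus those of the series.\<close>

lemma phi_eq_sum_elliptic_series:
  assumes \<tau>: "Im \<tau> > 0" and m: "even m" and z: "z \<in> {z. \<bar>Im z\<bar> < Im \<tau>} - \<int>"
  shows "phi m z \<tau> = chi_0 m \<tau> +
    (\<Sum>j=1..m div 2. D m (2 * j) \<tau> / fact (2 * j - 1) * elliptic_series (2 * j - 1) \<tau> z)"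
proof -
  define d where "d j = D m (2 * j) \<tau> / fact (2 * j - 1)" for j
  define s where "s j = (\<Sum>\<^sub>\<infinity>l\<in>{1..}. of_nat (divisor_power_sum (2 * j - 1) l) * nome \<tau> ^ l)" for j
  define c where "c j = - of_real (bernoulli_number (2 * j)) / of_nat (2 * j) + 2 * s j" for j
  define f where "f z = phi m z \<tau> - (\<Sum>j=1..m div 2. d j * elliptic_series (2 * j - 1) \<tau> z)" for z
  have odd: "odd (2 * j - 1)" if "j \<in> {1..m div 2}" for j :: nat
    using that by auto
  have hol: "f holomorphic_on ({z. \<bar>Im z\<bar> < Im \<tau>} - \<int>)"
    unfolding f_def phi_altdef using odd
    by (intro holomorphic_on_diff holomorphic_on_power theta_ratio_holomorphic \<tau> holomorphic_on_sum
        holomorphic_on_mult holomorphic_on_const elliptic_series_holomorphic)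
  have per: "f (z + 1) = f z" for z
    unfolding f_def phi_altdef theta_ratio_plus_1 using odd \<tau>
    by (intro arg_cong2[where f = "(-)"] sum.cong refl) (simp add: elliptic_series_plus_1)
  have quasi: "f (z + \<tau>) = f z" if "- Im \<tau> < Im z" "Im z < 0" for z
    unfolding f_def phi_altdef theta_ratio_plus_tau using odd \<tau> m that
    by (intro arg_cong2[where f = "(-)"] sum.cong refl) (simp_all add: elliptic_series_plus_tau)
  have lim: "(f \<longlongrightarrow> D m 0 \<tau> - (\<Sum>j=1..m div 2. d j * c j)) (at 0)"
  proof -
    have summand: "((\<lambda>z. d j * (elliptic_series (2 * j - 1) \<tau> z - fact (2 * j - 1) / (2 * of_real pi * \<i> * z) ^ (2 * j)))
        \<longlongrightarrow> d j * c j) (at 0)" if "j \<in> {1..m div 2}" for j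
    proof -
      have "Suc (2 * j - 1) = 2 * j" using that by auto
      then show ?thesis using elliptic_series_limit[OF \<tau> odd[OF that]]
        unfolding c_def s_def by (intro tendsto_mult tendsto_const) simp
    qed
    have "((\<lambda>z. (phi m z \<tau> - (\<Sum>j=1..m div 2. D m (2 * j) \<tau> / (2 * of_real pi * \<i> * z) ^ (2 * j))) -
        (\<Sum>j=1..m div 2. d j * (elliptic_series (2 * j - 1) \<tau> z - fact (2 * j - 1) / (2 * of_real pi * \<i> * z) ^ (2 * j))))
        \<longlongrightarrow> D m 0 \<tau> - (\<Sum>j=1..m div 2. d j * c j)) (at 0)"
      by (intro tendsto_diff phi_minus_principal_part_limit \<tau> m tendsto_sum summand)
    moreover have "(phi m z \<tau> - (\<Sum>j=1..m div 2. D m (2 * j) \<tau> / (2 * of_real pi * \<i> * z) ^ (2 * j))) -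
        (\<Sum>j=1..m div 2. d j * (elliptic_series (2 * j - 1) \<tau> z - fact (2 * j - 1) / (2 * of_real pi * \<i> * z) ^ (2 * j))) = f z" for z
      unfolding f_def right_diff_distrib sum_subtractf d_def by simp
    ultimately show ?thesis by (simp only:)
  qed
  have lim0: "((\<lambda>z. z * f z) \<longlongrightarrow> 0) (at 0)"
    using tendsto_mult[OF tendsto_ident_at lim] by simp
  obtain C where C: "\<And>z. z \<in> {z. \<bar>Im z\<bar> < Im \<tau>} - \<int> \<Longrightarrow> f z = C"
    by (rule quasi_elliptic_on_strip_constant[OF \<tau> hol per _ lim0]) (use quasi in auto)
  have "eventually (\<lambda>z. f z = C) (at 0)"
    using eventually_at_0_in_punctured_strip[OF \<tau>] by eventually_elim (rule C)
  then have "(f \<longlongrightarrow> C) (at 0)" by (rule tendsto_eventually)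
  then have "C = D m 0 \<tau> - (\<Sum>j=1..m div 2. d j * c j)"
    using lim by (rule tendsto_unique[OF at_neq_bot])
  also have "\<dots> = chi_0 m \<tau>"
  proof -
    have "- (d j * c j) = of_real (bernoulli_number (2 * j)) / fact (2 * j) * D m (2 * j) \<tau> * eisenstein_E (2 * j) \<tau>"
      if "j \<in> {1..m div 2}" for j
    proof -
      have B: "complex_of_real (bernoulli_number (2 * j)) \<noteq> 0"
        using bernoulli_number_even_nonzero[of "2 * j"] that by simp
      have j: "2 * j = Suc (2 * j - 1)" using that by auto
      have fac: "(fact (2 * j) :: complex) = of_nat (2 * j) * fact (2 * j - 1)"
        by (subst (1 2) j) (simp only: fact_Suc)
      have "of_nat (2 * j) \<noteq> (0 :: complex)" using that by simp
      moreover have "(fact (2 * j - 1) :: complex) \<noteq> 0" by simp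
      moreover have "eisenstein_E (2 * j) \<tau> = 1 - 2 * of_nat (2 * j) / of_real (bernoulli_number (2 * j)) * s j"
        unfolding eisenstein_E_def s_def by simp
      \<comment> \<open>The factor B / k has to be extracted from - B / k + 2 s, which is where
        B_{2j} being nonzero is used.\<close>
      moreover have "- (x / F * (- b / n + 2 * y)) = b / (n * F) * x * (1 - 2 * n / b * y)"
        if "n \<noteq> 0" "F \<noteq> 0" "b \<noteq> 0" for x y F b n :: complex
        using that by (simp add: field_simps)
      ultimately show ?thesis
        unfolding d_def c_def fac using B by metis
    qed
    then have "(\<Sum>j=1..m div 2. - (d j * c j)) = (\<Sum>j=1..m div 2. of_real (bernoulli_number (2 * j)) / fact (2 * j) *
        D m (2 * j) \<tau> * eisenstein_E (2 * j) \<tau>)"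
      by (intro sum.cong refl)
    then show ?thesis unfolding chi_0_def by (simp add: sum_negf)
  qed
  finally have "C = chi_0 m \<tau>" .
  then have "f z = chi_0 m \<tau>" using C[OF z] by simp
  then show ?thesis unfolding f_def d_def by (simp add: diff_eq_eq)
qed

lemma phi_has_fourier_expansion:
  assumes \<tau>: "Im \<tau> > 0" and m: "even m"
  shows "has_fourier_expansion m \<tau> (\<lambda>r. if r = 0 then chi_0 m \<tau> else
      1 / (1 - nome \<tau> powi r) * (\<Sum>j=1..m div 2. of_int r ^ (2 * j - 1) / fact (2 * j - 1) * D m (2 * j) \<tau>))"
    (is "has_fourier_expansion m \<tau> ?c")
  unfolding has_fourier_expansion_def
proof (intro allI impI)
  fix z assume z: "0 < Im z \<and> Im z < Im \<tau>"
  define e where "e j r = of_int r ^ (2 * j - 1) / (1 - nome \<tau> powi r) * nome z powi r" for j :: nat and r :: int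
  have "((\<lambda>r. D m (2 * j) \<tau> / fact (2 * j - 1) * e j r) has_sum
      (D m (2 * j) \<tau> / fact (2 * j - 1) * elliptic_series (2 * j - 1) \<tau> z)) UNIV" if "j \<in> {1..m div 2}" for j
    unfolding e_def using that z by (intro has_sum_cmult_right elliptic_series_fourier \<tau>) auto
  then have main_sum: "((\<lambda>r. \<Sum>j=1..m div 2. D m (2 * j) \<tau> / fact (2 * j - 1) * e j r) has_sum
      (\<Sum>j=1..m div 2. D m (2 * j) \<tau> / fact (2 * j - 1) * elliptic_series (2 * j - 1) \<tau> z)) UNIV"
    by (intro has_sum_finite_sum) auto
  \<comment> \<open>The constant is a Fourier series supported at r = 0, where every elliptic series
    has coefficient 0.\<close>
  have const_sum: "((\<lambda>r. if r = 0 then chi_0 m \<tau> else 0) has_sum chi_0 m \<tau>) UNIV"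
    by (rule has_sum_finite_neutralI[of "{0}"]) auto
  have zs: "z \<in> {z. \<bar>Im z\<bar> < Im \<tau>} - \<int>" using z by (auto elim!: Ints_cases)
  from has_sum_add[OF const_sum main_sum] have "((\<lambda>r. (if r = 0 then chi_0 m \<tau> else 0) +
      (\<Sum>j=1..m div 2. D m (2 * j) \<tau> / fact (2 * j - 1) * e j r)) has_sum phi m z \<tau>) UNIV"
    unfolding phi_eq_sum_elliptic_series[OF \<tau> m zs] .
  moreover have "(if r = 0 then chi_0 m \<tau> else 0) + (\<Sum>j=1..m div 2. D m (2 * j) \<tau> / fact (2 * j - 1) * e j r) =
      ?c r * nome z powi r" for r
  proof (cases "r = 0")
    case True
    then have "(\<Sum>j=1..m div 2. D m (2 * j) \<tau> / fact (2 * j - 1) * e j r) = 0"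
      by (intro sum.neutral) (auto simp: e_def)
    then show ?thesis using True by simp
  next
    case False
    then show ?thesis unfolding e_def sum_distrib_left sum_distrib_right
      by (simp add: sum_distrib_left sum_distrib_right) (intro sum.cong refl; simp add: mult_ac)
  qed
  ultimately show "((\<lambda>r. ?c r * exp (2 * of_real pi * \<i> * z) powi r) has_sum phi m z \<tau>) UNIV"
    by (simp add: nome_def)
qed

lemma chi_eqI:
  assumes "Im \<tau> > 0" "has_fourier_expansion m \<tau> c"
  shows "chi m r \<tau> = c r"
proof -
  have "(THE c. has_fourier_expansion m \<tau> c) = c"
    using assms has_fourier_expansion_unique by (intro the_equality) auto
  then show ?thesis by (simp add: chi_def)
qed

section \<open>Modular transformations\<close>

text \<open>The residue is theta(1/2) / theta'(0); the numerator is nonzero because 1/2 is not a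
  lattice point.\<close>

lemma theta_ratio_residue:
  assumes "Im \<tau> > 0"
  obtains \<rho> where "((\<lambda>z. z * theta_ratio z \<tau>) \<longlongrightarrow> \<rho>) (at 0)" "\<rho> \<noteq> 0"
proof -
  have "((\<lambda>z. jacobi_theta z \<tau> / z) \<longlongrightarrow> theta_deriv 1 0 \<tau>) (at 0)"
    using theta_deriv_has_field_derivative[OF assms, of 0 0]
    by (simp add: DERIV_def theta_deriv_0 jacobi_theta_0)
  moreover have "isCont (\<lambda>z. jacobi_theta z \<tau>) (0 + 1/2)"
    using theta_deriv_has_field_derivative[OF assms, of 0 "0 + 1/2"] unfolding theta_deriv_0 by (rule DERIV_isCont)
  then have "isCont (\<lambda>z. jacobi_theta (z + 1/2) \<tau>) 0"
    by (rule isCont_o2[of 0 "\<lambda>z. z + 1/2", rotated]) simp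
  then have "((\<lambda>z. jacobi_theta (z + 1/2) \<tau>) \<longlongrightarrow> jacobi_theta (1/2) \<tau>) (at 0)"
    by (simp add: isCont_def)
  ultimately have "((\<lambda>z. jacobi_theta (z + 1/2) \<tau> / (jacobi_theta z \<tau> / z)) \<longlongrightarrow>
      jacobi_theta (1/2) \<tau> / theta_deriv 1 0 \<tau>) (at 0)"
    using theta_deriv_1_nonzero[OF assms] by (intro tendsto_divide) auto
  moreover have "jacobi_theta (1/2) \<tau> \<noteq> 0"
  proof
    assume "jacobi_theta (1/2) \<tau> = 0"
    then obtain a b where ab: "1/2 = of_int a + of_int b * \<tau>"
      using jacobi_theta_eq_0_iff[OF assms] by blast
    have "Im (of_int a + of_int b * \<tau>) = 0" unfolding ab[symmetric] by simp
    then have "b = 0" using assms by simp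
    have "Re (of_int a + of_int b * \<tau>) = 1/2" unfolding ab[symmetric] by simp
    then have "real_of_int (2 * a) = of_int 1" using \<open>b = 0\<close> by simp
    then have "2 * a = 1" by (simp only: of_int_eq_iff)
    then show False by presburger
  qed
  ultimately show ?thesis
    using theta_deriv_1_nonzero[OF assms]
    by (intro that[of "jacobi_theta (1/2) \<tau> / theta_deriv 1 0 \<tau>"]) (auto simp: theta_ratio_def mult.commute)
qed

locale modular_transformation =
  fixes a b c d :: int and \<tau> :: complex
  assumes det: "a * d - b * c = 1" and even_c: "even c" and \<tau>: "Im \<tau> > 0"
begin

definition j :: complex where "j = of_int c * \<tau> + of_int d"

definition \<tau>' :: complex where "\<tau>' = (of_int a * \<tau> + of_int b) / j"

lemma odd_d: "odd d"
proof
  assume "even d"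
  then have "even (a * d - b * c)" using even_c by simp
  then show False using det by simp
qed

lemma j_nonzero: "j \<noteq> 0"
proof
  assume "j = 0"
  then have 0: "of_int c * \<tau> + of_int d = 0" by (simp only: j_def)
  then have "Im (of_int c * \<tau> + of_int d) = 0" by (simp only: zero_complex.sel)
  then have "c = 0" using \<tau> by simp
  then have "d = 0" using 0 by simp
  then show False using \<open>c = 0\<close> det by simp
qed

lemma j_times_tau': "j * \<tau>' = of_int a * \<tau> + of_int b"
  using j_nonzero by (simp add: \<tau>'_def)

lemma Im_tau': "Im \<tau>' > 0"
proof -
  have "Im \<tau>' = Im ((of_int a * \<tau> + of_int b) * cnj j) / (cmod j)\<^sup>2"
    unfolding \<tau>'_def by (simp add: Im_divide cmod_power2 algebra_simps)
  also have "Im ((of_int a * \<tau> + of_int b) * cnj j) = of_int (a * d - b * c) * Im \<tau>"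
    by (simp add: j_def algebra_simps)
  finally show ?thesis using det \<tau> j_nonzero by simp
qed

lemma lattice_subset:
  assumes "jacobi_theta (z / j) \<tau>' = 0"
  obtains k l where "z = of_int k + of_int l * \<tau>"
proof -
  obtain p n where pn: "z / j = of_int p + of_int n * \<tau>'"
    using jacobi_theta_eq_0_iff[OF Im_tau'] assms by blast
  then have "z = of_int p * j + of_int n * (j * \<tau>')"
    using j_nonzero by (simp add: field_simps)
  also have "\<dots> = of_int (p * d + n * b) + of_int (p * c + n * a) * \<tau>"
    unfolding j_times_tau' by (simp add: j_def algebra_simps)
  finally show ?thesis by (rule that)
qed

text \<open>Rescaling by j turns the period lattice of the quotient at the transformed point back
  into the one spanned by 1 and tau, so both quotients can be compared as functions of the same
  z.\<close>

definition F :: "complex \<Rightarrow> complex" where "F z = theta_ratio (z / j) \<tau>'"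

lemma F_plus_j: "F (z + j) = F z"
  using j_nonzero theta_ratio_plus_1[of "z / j" \<tau>'] by (simp add: F_def add_divide_distrib)

lemma F_plus_j_tau': "F (z + j * \<tau>') = - F z"
  using j_nonzero theta_ratio_plus_tau[of "z / j" \<tau>'] by (simp add: F_def add_divide_distrib)

lemma F_plus_lattice: "F (z + of_int n * j + of_int k * (j * \<tau>')) = (-1) powi k * F z"
proof -
  have 1: "F (w + of_int n * j) = F w" for w
    using periodic_int_shift[of UNIV "\<lambda>x. F (x * j)" "w / j" n] j_nonzero
    by (simp add: ring_distribs F_plus_j)
  have nz: "j * \<tau>' \<noteq> 0" using j_nonzero Im_tau' by auto
  have "(-1) powi (- k) * F (w + of_int k * (j * \<tau>')) = F w" for w
  proof -
    define x where "x = w / (j * \<tau>')"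
    \<comment> \<open>The factor exp (pi i x) changes sign under x -> x + 1 and so converts
      antiperiodicity into periodicity.\<close>
    have "(\<lambda>x. exp (\<i> * of_real pi * x) * F (x * (j * \<tau>'))) (x + of_int k) =
        (\<lambda>x. exp (\<i> * of_real pi * x) * F (x * (j * \<tau>'))) x"
      by (rule periodic_int_shift[of UNIV]) (auto simp: ring_distribs F_plus_j_tau' exp_add)
    then have "exp (\<i> * of_real pi * of_int k) * F (x * (j * \<tau>') + of_int k * (j * \<tau>')) = F (x * (j * \<tau>'))"
      by (simp add: ring_distribs exp_add)
    moreover have "exp (\<i> * of_real pi * of_int k) = (-1) powi (- k)"
    proof -
      have "exp (\<i> * of_real pi * of_int k) = (-1) powi k"
        using exp_power_int[of "\<i> * of_real pi" k] by (simp add: mult_ac)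
      then show ?thesis by (cases "even k") (simp_all add: power_int_minus_left_even power_int_minus_left_odd)
    qed
    moreover have "x * (j * \<tau>') = w" using nz by (simp add: x_def)
    ultimately show ?thesis by metis
  qed
  from this[of "z + of_int n * j"] show ?thesis using 1[of z]
    by (simp add: power_int_minus field_simps)
qed

text \<open>This and \<open>tau_eq\<close> invert the change of lattice basis; determinant 1 keeps
  the coefficients integral.\<close>

lemma one_eq: "1 = of_int a * j - of_int c * (j * \<tau>')"
proof -
  have "of_int a * j - of_int c * (j * \<tau>') = of_int (a * d - b * c)"
    unfolding j_times_tau' unfolding j_def by (simp add: algebra_simps)
  then show ?thesis using det by simp
qed

lemma tau_eq: "\<tau> = of_int d * (j * \<tau>') - of_int b * j"
proof -
  have "of_int d * (j * \<tau>') - of_int b * j = of_int (a * d - b * c) * \<tau>"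
    unfolding j_times_tau' unfolding j_def by (simp add: algebra_simps)
  then show ?thesis using det by simp
qed

text \<open>The level 2 enters here and in \<open>F_plus_tau\<close>: 1 contains j tau' with the
  even multiplicity - c, and tau contains it with the odd multiplicity d, so F has the same signs
  under 1 and tau as \<open>theta_ratio\<close>.\<close>

lemma F_plus_1: "F (z + 1) = F z"
proof -
  have "F (z + (of_int a * j - of_int c * (j * \<tau>'))) = F z"
    using F_plus_lattice[of z a "- c"] even_c by (simp add: algebra_simps power_int_minus_left_even)
  then show ?thesis by (simp only: one_eq[symmetric])
qed

lemma F_plus_tau: "F (z + \<tau>) = - F z"
proof -
  have "F (z + (of_int d * (j * \<tau>') - of_int b * j)) = - F z"
    using F_plus_lattice[of z "- b" d] odd_d by (simp add: algebra_simps power_int_minus_left_odd)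
  then show ?thesis by (simp only: tau_eq[symmetric])
qed

lemma F_holomorphic: "F holomorphic_on ({z. \<bar>Im z\<bar> < Im \<tau>} - \<int>)"
proof -
  have nz: "jacobi_theta (z / j) \<tau>' \<noteq> 0" if z: "z \<in> {z. \<bar>Im z\<bar> < Im \<tau>} - \<int>" for z
  proof
    assume "jacobi_theta (z / j) \<tau>' = 0"
    then obtain k l where kl: "z = of_int k + of_int l * \<tau>" by (rule lattice_subset)
    then have "\<bar>of_int l\<bar> * Im \<tau> < 1 * Im \<tau>" using z \<tau> by (simp add: abs_mult)
    then have "\<bar>real_of_int l\<bar> < 1" using \<tau> by (simp add: mult_less_cancel_right)
    then have "l = 0" by linarith
    then show False using z kl by simp
  qed
  have "(\<lambda>z. jacobi_theta (z / j + x) \<tau>') holomorphic_on A" for A x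
    by (rule holomorphic_on_compose_gen[of "\<lambda>z. z / j + x" A "\<lambda>z. jacobi_theta z \<tau>'" UNIV, unfolded o_def])
       (use j_nonzero in \<open>auto intro!: holomorphic_intros jacobi_theta_holomorphic Im_tau'\<close>)
  from this[of "1/2"] this[of 0] show ?thesis unfolding F_def theta_ratio_def using nz
    by (intro holomorphic_on_divide) auto
qed

text \<open>
  \<open>F\<close> and \<open>theta_ratio\<close> have the same simple poles; a combination without poles is constant on
  the strip, and vanishes because it is antiperiodic under \<open>\<tau>\<close>.
\<close>

lemma F_eq_const_times_theta_ratio:
  obtains \<kappa> where "\<And>z. z \<in> {z. \<bar>Im z\<bar> < Im \<tau>} - \<int> \<Longrightarrow> F z = \<kappa> * theta_ratio z \<tau>"
proof -
  obtain \<rho> where \<rho>: "((\<lambda>z. z * theta_ratio z \<tau>) \<longlongrightarrow> \<rho>) (at 0)" "\<rho> \<noteq> 0"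
    by (rule theta_ratio_residue[OF \<tau>])
  obtain \<rho>' where \<rho>': "((\<lambda>z. z * theta_ratio z \<tau>') \<longlongrightarrow> \<rho>') (at 0)" "\<rho>' \<noteq> 0"
    by (rule theta_ratio_residue[OF Im_tau'])
  have "filterlim (\<lambda>z. z / j) (at 0) (at 0)"
    using j_nonzero by (intro filterlim_atI) (auto intro!: tendsto_eq_intros simp: eventually_at_filter)
  from filterlim_compose[OF \<rho>'(1) this]
  have "((\<lambda>z. j * (z / j * F z)) \<longlongrightarrow> j * \<rho>') (at 0)"
    unfolding F_def by (intro tendsto_mult tendsto_const)
  then have F_res: "((\<lambda>z. z * F z) \<longlongrightarrow> j * \<rho>') (at 0)" using j_nonzero by simp
  \<comment> \<open>The ratio of the residues at 0; the factor j comes from the rescaled argument of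
    F.\<close>
  define \<kappa> where "\<kappa> = j * \<rho>' / \<rho>"
  define f where "f z = F z - \<kappa> * theta_ratio z \<tau>" for z
  have hol: "f holomorphic_on ({z. \<bar>Im z\<bar> < Im \<tau>} - \<int>)"
    unfolding f_def by (intro holomorphic_intros F_holomorphic theta_ratio_holomorphic \<tau>)
  have per: "f (z + 1) = f z" for z
    by (simp add: f_def F_plus_1 theta_ratio_plus_1)
  have anti: "f (z + \<tau>) = - f z" for z
    by (simp add: f_def F_plus_tau theta_ratio_plus_tau)
  have "((\<lambda>z. z * F z - \<kappa> * (z * theta_ratio z \<tau>)) \<longlongrightarrow> j * \<rho>' - \<kappa> * \<rho>) (at 0)"
    by (intro tendsto_intros F_res \<rho>)
  then have lim: "((\<lambda>z. z * f z) \<longlongrightarrow> 0) (at 0)"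
    using \<rho>(2) by (simp add: f_def \<kappa>_def algebra_simps)
  \<comment> \<open>Only moduli are compared across tau, so an antiperiodic function is
    admissible.\<close>
  obtain C where C: "\<And>z. z \<in> {z. \<bar>Im z\<bar> < Im \<tau>} - \<int> \<Longrightarrow> f z = C"
    by (rule quasi_elliptic_on_strip_constant[OF \<tau> hol per _ lim]) (auto simp: anti)
  \<comment> \<open>Both w and w + tau lie in the strip, at heights - Im tau / 2 and Im tau / 2, so
    antiperiodicity gives C = - C.\<close>
  define w where "w = - (\<i> * of_real (Im \<tau> / 2))"
  have "w \<notin> \<int>" "w + \<tau> \<notin> \<int>" using \<tau> by (auto simp: w_def complex_is_Int_iff)
  then have "f w = C" "f (w + \<tau>) = C" using \<tau> by (auto intro!: C simp: w_def)
  then have "C = 0" using anti[of w] by simp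
  then show ?thesis using C by (intro that[of \<kappa>]) (simp add: f_def)
qed

lemma phi_transform:
  assumes m: "even m" and z: "z \<in> {z. \<bar>Im z\<bar> < Im \<tau>} - \<int>"
  shows "phi m (z / j) \<tau>' = (-1) powi (int m * c div 4) * phi m z \<tau>"
proof -
  obtain \<kappa> where \<kappa>: "\<And>z. z \<in> {z. \<bar>Im z\<bar> < Im \<tau>} - \<int> \<Longrightarrow> F z = \<kappa> * theta_ratio z \<tau>"
    using F_eq_const_times_theta_ratio by blast
  obtain c' where c': "c = 2 * c'" using even_c by auto
  obtain d' where d': "d = 2 * d' + 1" using odd_d by (auto elim: oddE)
  \<comment> \<open>The half period 1/2 of the transformed quotient becomes j / 2, which differs
    from 1/2 by a lattice point with tau-multiplicity c / 2; this is the source of the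
    character.\<close>
  have j_half: "j / 2 = of_int c' * \<tau> + of_int d' + 1/2"
    unfolding j_def by (simp add: c' d' field_simps)
  obtain m' where m': "m = 2 * m'" using m by auto
  \<comment> \<open>At height Im tau / 2 all three points needed avoid the lattice, since their
    heights are half-odd multiples of Im tau.\<close>
  define w where "w = \<i> * of_real (Im \<tau> / 2)"
  have w: "\<not> (\<exists>k l. w = of_int k + of_int l * \<tau>)" "\<not> (\<exists>k l. w + 1/2 = of_int k + of_int l * \<tau>)"
      "\<not> (\<exists>k l. w + j / 2 = of_int k + of_int l * \<tau>)"
  proof -
    have *: False if "Im \<tau> / 2 = of_int l * Im \<tau>" for l
    proof -
      have "real_of_int (2 * l) = of_int 1" using that \<tau> by simp
      then have "2 * l = 1" by (simp only: of_int_eq_iff)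
      then show False by presburger
    qed
    show "\<not> (\<exists>k l. w = of_int k + of_int l * \<tau>)" using * by (auto simp: w_def complex_eq_iff)
    show "\<not> (\<exists>k l. w + 1/2 = of_int k + of_int l * \<tau>)" using * by (auto simp: w_def complex_eq_iff)
    show "\<not> (\<exists>k l. w + j / 2 = of_int k + of_int l * \<tau>)"
    proof safe
      fix k l assume "w + j / 2 = of_int k + of_int l * \<tau>"
      then have "Im (w + j / 2) = Im (of_int k + of_int l * \<tau>)" by (rule arg_cong)
      then have "Im \<tau> / 2 = of_int (l - c') * Im \<tau>" unfolding j_half by (simp add: w_def algebra_simps)
      then show False by (rule *)
    qed
  qed
  have strip: "w \<in> {z. \<bar>Im z\<bar> < Im \<tau>} - \<int>" "w + 1/2 \<in> {z. \<bar>Im z\<bar> < Im \<tau>} - \<int>"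
    using \<tau> by (auto simp: w_def complex_is_Int_iff)
  have "F w * F (w + j / 2) = - 1"
  proof -
    have "jacobi_theta (w / j) \<tau>' \<noteq> 0" using w(1) lattice_subset by blast
    moreover have "jacobi_theta ((w + j / 2) / j) \<tau>' \<noteq> 0" using w(3) lattice_subset by blast
    moreover have "(w + j / 2) / j = w / j + 1/2" using j_nonzero by (simp add: field_simps)
    ultimately show ?thesis unfolding F_def using theta_ratio_half_period by simp
  qed
  moreover have "F (w + j / 2) = (-1) powi c' * F (w + 1/2)"
  proof -
    have F1: "F (x + of_int n) = F x" for x n
      by (rule periodic_int_shift[of UNIV]) (auto simp: F_plus_1)
    have Ft: "F (x + of_int n * \<tau>) = (-1) powi n * F x" for x n
    proof -
      have "x + of_int n * (of_int d * (j * \<tau>') - of_int b * j) =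
          x + of_int (- n * b) * j + of_int (n * d) * (j * \<tau>')"
        by (simp add: algebra_simps)
      then have "x + of_int n * \<tau> = x + of_int (- n * b) * j + of_int (n * d) * (j * \<tau>')"
        by (simp only: tau_eq[symmetric])
      then have "F (x + of_int n * \<tau>) = (-1) powi (n * d) * F x"
        by (simp only: F_plus_lattice)
      also have "(-1) powi (n * d) = ((-1) powi n :: complex)"
        using odd_d by (cases "even n") (simp_all add: power_int_minus_left_even power_int_minus_left_odd)
      finally show ?thesis .
    qed
    have "w + j / 2 = (w + 1/2) + of_int d' + of_int c' * \<tau>"
      unfolding j_half by simp
    then show ?thesis by (simp only: Ft F1)
  qed
  moreover have "theta_ratio w \<tau> * theta_ratio (w + 1/2) \<tau> = - 1"
    using w(1,2) jacobi_theta_eq_0_iff[OF \<tau>] by (intro theta_ratio_half_period) blast+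
  moreover have "F w * ((-1) powi c' * F (w + 1/2)) =
      (-1) powi c' * \<kappa>\<^sup>2 * (theta_ratio w \<tau> * theta_ratio (w + 1/2) \<tau>)"
    by (simp add: \<kappa>[OF strip(1)] \<kappa>[OF strip(2)] power2_eq_square)
  \<comment> \<open>The relation f(z) f(z + 1/2) = -1 is evaluated for F with half period j / 2 and
    for \<open>theta_ratio\<close> with half period 1/2.\<close>
  ultimately have "(-1) powi c' * \<kappa>\<^sup>2 = 1" by simp
  moreover have "(-1) powi c' * (-1) powi c' = (1 :: complex)"
    by (cases "even c'") (simp_all add: power_int_minus_left_even power_int_minus_left_odd)
  ultimately have \<kappa>2: "\<kappa>\<^sup>2 = (-1) powi c'"
    by (metis mult.assoc mult.commute mult_1)
  have "int m * c div 4 = c' * int m'" by (simp add: m' c')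
  then have psi_eq: "(-1) powi (int m * c div 4) = ((-1) powi c' :: complex) ^ m'"
    by (simp add: power_int_mult)
  have "phi m (z / j) \<tau>' = F z ^ m" by (simp add: phi_altdef F_def)
  also have "\<dots> = \<kappa> ^ m * phi m z \<tau>" by (simp add: \<kappa>[OF z] phi_altdef power_mult_distrib)
  also have "\<kappa> ^ m = ((-1) powi c') ^ m'" by (simp add: m' power_mult \<kappa>2)
  finally show ?thesis by (simp only: psi_eq)
qed

text \<open>By uniqueness, \<open>phi_transform\<close> may be read coefficientwise: replacing z by
  z / j multiplies the coefficient of z^(-k) by j^k, whence weight - k.\<close>

lemma D_transform:
  assumes m: "even m" and k: "k \<le> m"
  shows "D m k \<tau>' = (-1) powi (int m * c div 4) * j powi (- int k) * D m k \<tau>"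
proof -
  define \<epsilon> :: complex where "\<epsilon> = (-1) powi (int m * c div 4)"
  define L where "L \<tau> = fls_shift (int m) (fps_to_fls (theta_ratio_fps \<tau> ^ m))" for \<tau>
  have L: "(\<lambda>z. phi m z t) has_laurent_expansion L t" if "Im t > 0" for t
    unfolding L_def by (rule phi_has_laurent_expansion[OF that])
  have s: "(\<lambda>z. phi m (inverse j * z) \<tau>') has_laurent_expansion fls_compose_fps (L \<tau>') (fps_const (inverse j) * fps_X)"
    using j_nonzero by (intro has_laurent_expansion_scale L Im_tau') simp
  have e: "(\<lambda>z. \<epsilon> * phi m z \<tau>) has_laurent_expansion fls_const \<epsilon> * L \<tau>"
    by (intro has_laurent_expansion_cmult_left L \<tau>)
  have ev: "eventually (\<lambda>z. phi m (inverse j * z) \<tau>' = \<epsilon> * phi m z \<tau>) (at 0)"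
    using eventually_at_0_in_punctured_strip[OF \<tau>]
    by eventually_elim (use phi_transform[OF m] in \<open>simp add: \<epsilon>_def divide_inverse mult.commute\<close>)
  have eq: "fls_compose_fps (L \<tau>') (fps_const (inverse j) * fps_X) = fls_const \<epsilon> * L \<tau>"
    using has_laurent_expansion_cong[OF ev refl, THEN iffD1, OF s] e by (rule has_laurent_expansion_unique)
  have "fls_nth (L \<tau>') (- int k) * inverse j powi (- int k) = \<epsilon> * fls_nth (L \<tau>) (- int k)"
    using fls_nth_fls_compose_fps_linear[of "inverse j" "L \<tau>'" "- int k"] j_nonzero unfolding eq by simp
  then have "fls_nth (L \<tau>') (- int k) = \<epsilon> * j powi (- int k) * fls_nth (L \<tau>) (- int k)"
    using j_nonzero by (simp add: power_int_minus power_int_inverse field_simps)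
  then show ?thesis
    unfolding D_def laurent_expansion_0_eqI[OF L[OF \<tau>]] laurent_expansion_0_eqI[OF L[OF Im_tau']] \<epsilon>_def
    by (simp only: mult_ac)
qed

end

lemma D_modular:
  assumes "even m" "2 * i \<le> m"
  shows "modular_form_Gamma0 2 (- 2 * int i) (psi m) (D m (2 * i))"
  unfolding modular_form_Gamma0_def
proof (intro conjI ballI)
  show "D m (2 * i) holomorphic_on upper_half_plane" by (rule D_holomorphic) fact
  fix A :: "int ^ 2 ^ 2" and \<tau> assume A: "A \<in> Gamma0 2" and \<tau>: "\<tau> \<in> upper_half_plane"
  interpret modular_transformation "A $ 1 $ 1" "A $ 1 $ 2" "A $ 2 $ 1" "A $ 2 $ 2" \<tau>
    by unfold_locales (use A \<tau> in \<open>auto simp: Gamma0_def det_2 mult.commute\<close>)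
  have "mat_act A \<tau> = \<tau>'" by (simp add: mat_act_def moebius_def \<tau>'_def j_def)
  then show "D m (2 * i) (mat_act A \<tau>) = psi m A * automorphy_factor A \<tau> powi (- 2 * int i) * D m (2 * i) \<tau>"
    using D_transform[OF assms] by (simp add: psi_def automorphy_factor_def j_def)
qed

theorem theorem1p1:
  fixes m :: nat
  assumes "m > 0" and "even m"
  shows
    "(\<forall>\<tau>\<in>upper_half_plane.
        has_fourier_expansion m \<tau> (\<lambda>r. chi m r \<tau>) \<and>
        (\<lambda>z. phi m z \<tau> - (\<Sum>j=0..m div 2. D m (2 * j) \<tau> / (2 * of_real pi * \<i> * z) ^ (2 * j)))
          \<in> O[at 0](\<lambda>z. z ^ 2) \<and>
        (\<forall>r::int. r \<noteq> 0 \<longrightarrow>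
          chi m r \<tau> = 1 / (1 - nome \<tau> powi r) *
            (\<Sum>j=1..m div 2. of_int r ^ (2 * j - 1) / fact (2 * j - 1) * D m (2 * j) \<tau>)) \<and>
        chi m 0 \<tau> = D m 0 \<tau> +
          (\<Sum>j=1..m div 2. of_real (bernoulli_number (2 * j)) / fact (2 * j) *
             D m (2 * j) \<tau> * eisenstein_E (2 * j) \<tau>)) \<and>
     (\<forall>j\<le>m div 2. modular_form_Gamma0 2 (- 2 * int j) (psi m) (D m (2 * j)))"
proof (intro conjI ballI allI impI)
  fix \<tau> assume "\<tau> \<in> upper_half_plane"
  then have \<tau>: "Im \<tau> > 0" by simp
  note fourier = phi_has_fourier_expansion[OF \<tau> \<open>even m\<close>]
  note chi = chi_eqI[OF \<tau> fourier]
  show "has_fourier_expansion m \<tau> (\<lambda>r. chi m r \<tau>)"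
    using fourier unfolding chi .
  show "(\<lambda>z. phi m z \<tau> - (\<Sum>j=0..m div 2. D m (2 * j) \<tau> / (2 * of_real pi * \<i> * z) ^ (2 * j)))
      \<in> O[at 0](\<lambda>z. z ^ 2)"
    by (rule phi_laurent_bigo) fact+
  show "chi m r \<tau> = 1 / (1 - nome \<tau> powi r) *
      (\<Sum>j=1..m div 2. of_int r ^ (2 * j - 1) / fact (2 * j - 1) * D m (2 * j) \<tau>)" if "r \<noteq> 0" for r
    using that unfolding chi by simp
  show "chi m 0 \<tau> = D m 0 \<tau> + (\<Sum>j=1..m div 2. of_real (bernoulli_number (2 * j)) / fact (2 * j) *
      D m (2 * j) \<tau> * eisenstein_E (2 * j) \<tau>)"
    unfolding chi by (simp add: chi_0_def)
next
  fix j assume "j \<le> m div 2"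
  then show "modular_form_Gamma0 2 (- 2 * int j) (psi m) (D m (2 * j))"
    using \<open>even m\<close> by (intro D_modular) auto
qed

end
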